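(* Let $\|\cdot\|$ be a norm on $\mathbb{R}^n$ with unit ball $\mathrm{B}=\{x:\|x\|\le 1\}$, let $K\subset\mathbb{R}^n$ be a convex body, and let $1\le i\le n$ with $\mathrm{r}_i(K,\mathrm{B})>0$. Then \[ \frac{\mathrm{R}_{n-i+1}(K,\mathrm{B})}{\mathrm{r}_i(K,\mathrm{B})}\leq n\sqrt{n}. \] If $\mathrm{B}$ is the Euclidean unit ball $\mathrm{B}_2$, or if $K$ is symmetric about the origin, the bound $n\sqrt n$ can be replaced by $n$. If both conditions hold, it can be replaced by $\sqrt{n}$.
   Context: A convex body is a compact convex subset of $\mathbb{R}^n$; $\mathcal{L}^n_j$ is the set of $j$-dimensional linear subspaces. For convex bodies $K,C$ and $1\le i\le n$: $\mathrm{R}_i(K,C)$ is the smallest $\rho\geq 0$ such that $K\subset x+\rho C+L$ for some $L\in\mathcal{L}^n_{n-i}$ and $x\in\mathbb{R}^n$; $\mathrm{r}_i(K,C)$ is the largest $\rho\geq0$ such that $x+\rho(C\cap L)\subset K$ for some $L\in\mathcal{L}^n_i$ and $x\in\mathbb{R}^n$. *)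

theory Defs
  imports "HOL-Analysis.Analysis"
begin

definition convex_body :: "'a::euclidean_space set \<Rightarrow> bool" where
  "convex_body K \<longleftrightarrow> compact K \<and> convex K"

definition is_norm :: "('a::euclidean_space \<Rightarrow> real) \<Rightarrow> bool" where
  "is_norm N \<longleftrightarrow> (\<forall>x. N x = 0 \<longleftrightarrow> x = 0) \<and>
                 (\<forall>c x. N (c *\<^sub>R x) = \<bar>c\<bar> * N x) \<and>
                 (\<forall>x y. N (x + y) \<le> N x + N y)"

definition lin_subspaces :: "nat \<Rightarrow> 'a::euclidean_space set set" where
  "lin_subspaces j = {L. subspace L \<and> dim L = j}"

definition circumradius_i :: "nat \<Rightarrow> 'a::euclidean_space set \<Rightarrow> 'a set \<Rightarrow> real" where
  "circumradius_i i K C = Inf {\<rho>. \<rho> \<ge> 0 \<and> (\<exists>L \<in> lin_subspaces (DIM('a) - i). \<exists>x.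
       K \<subseteq> {x + \<rho> *\<^sub>R c + l | c l. c \<in> C \<and> l \<in> L})}"

definition inradius_i :: "nat \<Rightarrow> 'a::euclidean_space set \<Rightarrow> 'a set \<Rightarrow> real" where
  "inradius_i i K C = Sup {\<rho>. \<rho> \<ge> 0 \<and> (\<exists>L \<in> lin_subspaces i. \<exists>x.
       (\<lambda>c. x + \<rho> *\<^sub>R c) ` (C \<inter> L) \<subseteq> K)}"

end

theory Submission
  imports Defs
begin

text \<open>
  By John's theorem \<open>K\<close> lies between \<open>c + E\<close> and \<open>c + \<kappa> E\<close> for an ellipsoid \<open>E\<close>, with
  \<open>\<kappa> = n\<close>, or \<open>\<kappa> = \<surd>n\<close> if \<open>K\<close> is symmetric; likewise the unit ball lies between \<open>F\<close> and
  \<open>\<mu> F\<close>, with \<open>\<mu> = \<surd>n\<close>, or \<open>\<mu> = 1\<close> in the Euclidean case. If \<open>\<sigma>\<close> is the \<open>i\<close>-th largest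
  semi-axis of \<open>E\<close> measured in the Euclidean structure whose ball is \<open>F\<close>, then the span of the first
  \<open>i\<close> axes shows that the inradius is at least \<open>\<sigma> / \<mu>\<close>, and the span of the first \<open>i - 1\<close> axes
  shows that the circumradius is at most \<open>\<kappa> \<sigma>\<close>.
\<close>

section \<open>John's theorem\<close>

text \<open>The obstacle is that \<open>K\<close> may be flat, so that \<open>E\<close> degenerates.
  Ellipsoids are therefore images of the unit ball \<open>B\<close> under linear maps:
  \<open>c + T B\<close> for \<open>K\<close>, \<open>S B\<close> for the norm ball.
  \<open>T\<close> may be singular, whereas \<open>S\<close> is onto because the norm ball is
  absorbing. The semi-axes become singular values of \<open>S^-1 T\<close>, zero included. The
  constants come from volume. An inscribed ellipsoid of largest volume is normalised to the unit
  ball; a point of the body at distance \<open>P\<close> lets it be stretched towards that point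
  while it is thinned across. To first order this gains volume once \<open>P > n\<close>, or once
  \<open>P^2 > n\<close> if the opposite point is available too. The same \<sigma> enters both
  radius estimates and cancels in the quotient, which leaves \<kappa> \<mu>.\<close>

lemma mem_closed_convex_support:
  fixes z :: "'a::euclidean_space"
  assumes "convex S" "closed S" "\<And>w. norm w = 1 \<Longrightarrow> \<exists>y\<in>S. w \<bullet> z \<le> w \<bullet> y"
  shows "z \<in> S"
proof (rule ccontr)
  assume "z \<notin> S"
  then obtain a b where ab: "a \<bullet> z < b" "\<forall>x\<in>S. a \<bullet> x > b"
    using separating_hyperplane_closed_point assms by blast
  obtain e :: 'a where "norm e = 1"
    using vector_choose_size[of 1] by auto
  then obtain y where "y \<in> S"
    using assms(3) by blast
  with ab have "a \<noteq> 0" by fastforce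
  then have "norm (- a /\<^sub>R norm a) = 1" by simp
  then obtain y where y: "y \<in> S" "(- a /\<^sub>R norm a) \<bullet> z \<le> (- a /\<^sub>R norm a) \<bullet> y"
    using assms(3) by blast
  then have "a \<bullet> y \<le> a \<bullet> z"
    using \<open>a \<noteq> 0\<close> by (simp add: field_simps)
  with ab y show False by fastforce
qed

section \<open>Ellipsoids of revolution larger than the unit ball\<close>

definition axial_matrix :: "'n::finite \<Rightarrow> real \<Rightarrow> real \<Rightarrow> real^'n^'n" where
  "axial_matrix k a b = (\<chi> i j. if i = j then (if i = k then a else b) else 0)"

lemma axial_matrix_mult: "axial_matrix k a b *v x = (\<chi> i. (if i = k then a else b) * x $ i)"
proof -
  have "(\<Sum>j\<in>UNIV. (if i = j then (if i = k then a else b) else 0) * x $ j)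
      = (\<Sum>j\<in>UNIV. if i = j then (if i = k then a else b) * x $ j else 0)" for i
    by (rule sum.cong) auto
  then show ?thesis
    by (simp add: axial_matrix_def matrix_vector_mult_def vec_eq_iff)
qed

lemma det_axial_matrix: "det (axial_matrix (k::'n::finite) a b) = a * b ^ (CARD('n) - 1)"
proof -
  have "det (axial_matrix k a b) = (\<Prod>i\<in>UNIV. if i = k then a else b)"
    by (subst det_diagonal) (auto simp: axial_matrix_def)
  also have "\<dots> = a * (\<Prod>i\<in>UNIV - {k}. if i = k then a else b)"
    by (subst prod.remove[of _ k]) auto
  also have "(\<Prod>i\<in>UNIV - {k}. if i = k then a else b) = (\<Prod>i\<in>UNIV - {k}. b)"
    by (rule prod.cong) auto
  finally show ?thesis by simp
qed

text \<open>The right-hand side is the length of \<open>D w\<close> for the axial matrix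
  \<open>D\<close>, that is, the support value at \<open>w\<close> of the image of the unit ball.
  The diagonal matrix moves to the other side of the inner product, and Cauchy-Schwarz does the
  rest.\<close>

lemma inner_axial_matrix_le:
  fixes w x :: "real^'n"
  assumes "norm w = 1" "norm x \<le> 1"
  shows "w \<bullet> (axial_matrix k a b *v x) \<le> sqrt (a\<^sup>2 * (w $ k)\<^sup>2 + b\<^sup>2 * (1 - (w $ k)\<^sup>2))"
proof -
  let ?D = "axial_matrix k a b"
  have "w \<bullet> (?D *v x) = (?D *v w) \<bullet> x"
    by (simp add: axial_matrix_mult inner_vec_def mult_ac)
  also have "\<dots> \<le> norm (?D *v w) * norm x"
    by (rule norm_cauchy_schwarz)
  also have "\<dots> \<le> norm (?D *v w)"
    using assms(2) by (simp add: mult_left_le)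
  also have "\<dots> = sqrt (a\<^sup>2 * (w $ k)\<^sup>2 + b\<^sup>2 * (1 - (w $ k)\<^sup>2))"
  proof -
    have "1 = (\<Sum>i\<in>UNIV. (w $ i)\<^sup>2)"
      using assms(1) by (simp add: norm_vec_def L2_set_def)
    also have "\<dots> = (w $ k)\<^sup>2 + (\<Sum>i\<in>UNIV - {k}. (w $ i)\<^sup>2)"
      by (subst sum.remove[of _ k]) auto
    finally have 1: "1 - (w $ k)\<^sup>2 = (\<Sum>i\<in>UNIV - {k}. (w $ i)\<^sup>2)" by simp
    have "(\<Sum>i\<in>UNIV. ((if i = k then a else b) * w $ i)\<^sup>2)
        = (a * w $ k)\<^sup>2 + (\<Sum>i\<in>UNIV - {k}. ((if i = k then a else b) * w $ i)\<^sup>2)"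
      by (subst sum.remove[of _ k]) auto
    also have "(\<Sum>i\<in>UNIV - {k}. ((if i = k then a else b) * w $ i)\<^sup>2)
        = (\<Sum>i\<in>UNIV - {k}. b\<^sup>2 * (w $ i)\<^sup>2)"
      by (rule sum.cong) (auto simp: power_mult_distrib)
    finally show ?thesis
      by (simp add: axial_matrix_mult norm_vec_def L2_set_def 1 sum_distrib_left power_mult_distrib)
  qed
  finally show ?thesis .
qed

text \<open>
  The new ellipsoid has centre \<open>\<delta> e\<close> and semi-axes \<open>1 + \<delta>\<close> along \<open>e\<close> and \<open>\<surd>\<beta>\<close> across, where
  \<open>\<beta>\<close> is the largest value for which it stays inside the convex hull of the unit ball and
  \<open>P e\<close>. The logarithmic derivative of its volume at \<open>\<delta> = 0\<close> is \<open>1 - (n - 1) / (P - 1)\<close>.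
\<close>
lemma larger_ellipsoid:
  fixes S :: "(real^'n) set"
  assumes S: "convex S" "closed S" "cball 0 1 \<subseteq> S" and p: "P *\<^sub>R axis k 1 \<in> S"
    and P: "P > real CARD('n)"
  obtains D d where "\<And>x. norm x \<le> 1 \<Longrightarrow> d + D *v x \<in> S" "det D > 1"
proof -
  define m where "m = real (CARD('n) - 1)"
  have card: "CARD('n) \<ge> 1" "real CARD('n) \<ge> 1"
    by (simp_all add: Suc_leI)
  have m: "0 \<le> m" "m < P - 1" "P > 1"
    using P card by (simp_all only: m_def of_nat_diff)
  define r where "r = m / (P - 1)"
  have r: "0 \<le> r" "r < 1" using m by (auto simp: r_def)
  \<comment> \<open>The first bound keeps the second-order term \<open>2 * r * \<delta>\<close>
    below the gain \<open>1 - r\<close>, which is positive because \<open>P > n\<close>. The second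
    gives \<open>\<beta> \<ge> 1/2\<close>.\<close>
  define \<delta> where "\<delta> = min ((1 - r) / 4) ((P - 1) / 4)"
  have \<delta>: "0 < \<delta>" using r m by (simp add: \<delta>_def)
  have \<delta>_le: "\<delta> \<le> (1 - r) / 4" "\<delta> \<le> (P - 1) / 4"
    unfolding \<delta>_def by (rule min.cobounded1, rule min.cobounded2)
  note \<delta> = \<delta> \<delta>_le
  define \<beta> where "\<beta> = 1 - 2 * \<delta> / (P - 1)"
  have \<beta>: "0 < \<beta>" "\<beta> \<le> 1" "(1 - \<beta>) * (P - 1) = 2 * \<delta>"
    using \<delta> m by (auto simp: \<beta>_def field_simps)
  define a where "a = 1 + \<delta>"
  define b where "b = sqrt \<beta>"
  have b: "b > 0" "b\<^sup>2 = \<beta>" using \<beta> by (auto simp: b_def)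
  let ?D = "axial_matrix k a b" and ?d = "\<delta> *\<^sub>R axis k 1"
  show ?thesis
  proof
    fix x :: "real^'n" assume x: "norm x \<le> 1"
    show "?d + ?D *v x \<in> S"
    proof (rule mem_closed_convex_support[OF S(1,2)])
      fix w :: "real^'n" assume w: "norm w = 1"
      define t where "t = w $ k"
      have t: "\<bar>t\<bar> \<le> 1" using component_le_norm_cart[of w k] w by (simp add: t_def)
      have "w \<bullet> (?d + ?D *v x) = \<delta> * t + w \<bullet> (?D *v x)"
        by (simp add: inner_add_right inner_axis t_def)
      also have "\<dots> \<le> \<delta> * t + sqrt (a\<^sup>2 * t\<^sup>2 + \<beta> * (1 - t\<^sup>2))"
        using inner_axial_matrix_le[OF w x, of k a b] by (simp add: t_def b)
      finally have le: "w \<bullet> (?d + ?D *v x) \<le> \<delta> * t + sqrt (a\<^sup>2 * t\<^sup>2 + \<beta> * (1 - t\<^sup>2))" .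
      \<comment> \<open>The convex hull of the unit ball and the tip \<open>P e\<close> has support
        value \<open>max 1 (P * t)\<close> at \<open>w\<close>, attained at \<open>w\<close> itself
        or at the tip. The two cases follow this maximum.\<close>
      show "\<exists>y\<in>S. w \<bullet> (?d + ?D *v x) \<le> w \<bullet> y"
      proof (cases "P * t \<le> 1")
        case True
        have "(1 - \<beta> + 2 * \<delta>) = (1 - \<beta>) * P"
          using \<beta>(3) by (simp add: algebra_simps)
        \<comment> \<open>The left-hand side is a quadratic in \<open>t\<close> with roots
          \<open>-1\<close> and \<open>1 / P\<close>, the places where the support values of the new
          ellipsoid and of the ball agree.\<close>
        then have "(1 - \<delta> * t)\<^sup>2 - (a\<^sup>2 * t\<^sup>2 + \<beta> * (1 - t\<^sup>2)) = (1 + t) * ((1 - \<beta>) * (1 - P * t))"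
          unfolding a_def by algebra
        also have "\<dots> \<ge> 0"
          using t True \<beta> by (intro mult_nonneg_nonneg) auto
        finally have "a\<^sup>2 * t\<^sup>2 + \<beta> * (1 - t\<^sup>2) \<le> (1 - \<delta> * t)\<^sup>2" by simp
        moreover have "\<delta> * t \<le> 1"
        proof -
          have "\<delta> * t \<le> \<delta> * 1" using \<delta> t by (intro mult_left_mono) auto
          also have "\<delta> * 1 \<le> 1" using \<delta>(2) r(1) by simp
          finally show ?thesis .
        qed
        ultimately have "sqrt (a\<^sup>2 * t\<^sup>2 + \<beta> * (1 - t\<^sup>2)) \<le> 1 - \<delta> * t"
          by (intro real_le_lsqrt) auto
        then have "w \<bullet> (?d + ?D *v x) \<le> w \<bullet> w"
          using le w by (simp add: dot_square_norm)
        moreover have "w \<in> S" using S(3) w by auto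
        ultimately show ?thesis by blast
      next
        case False
        then have Pt: "P * t > 1" by simp
        then have "t > 0" using m by (smt (verit) zero_less_mult_iff)
        have "1 \<le> (P * t)\<^sup>2" using Pt by (simp add: one_le_power)
        have "(1 - \<beta> + 2 * \<delta>) = (1 - \<beta>) * P"
          using \<beta>(3) by (simp add: algebra_simps)
        then have "((P - \<delta>) * t)\<^sup>2 - (a\<^sup>2 * t\<^sup>2 + \<beta> * (1 - t\<^sup>2)) = \<beta> * ((P * t)\<^sup>2 - 1)"
          unfolding a_def by algebra
        also have "\<dots> \<ge> 0"
          using \<open>1 \<le> (P * t)\<^sup>2\<close> \<beta> by auto
        finally have "a\<^sup>2 * t\<^sup>2 + \<beta> * (1 - t\<^sup>2) \<le> ((P - \<delta>) * t)\<^sup>2" by simp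
        moreover have "(P - \<delta>) * t \<ge> 0"
          using \<delta> m \<open>t > 0\<close> by (intro mult_nonneg_nonneg) auto
        ultimately have "sqrt (a\<^sup>2 * t\<^sup>2 + \<beta> * (1 - t\<^sup>2)) \<le> (P - \<delta>) * t"
          by (intro real_le_lsqrt) auto
        then have "w \<bullet> (?d + ?D *v x) \<le> P * t"
          using le by (simp add: algebra_simps)
        also have "P * t = w \<bullet> (P *\<^sub>R axis k 1)"
          by (simp add: inner_axis t_def)
        finally show ?thesis using p by blast
      qed
    qed
  next
    \<comment> \<open>The determinant is squared to remove the root in \<open>b\<close>. Bernoulli's
      inequality then bounds the power of \<beta> below by a linear expression in \<delta>.\<close>
    have "1 < (1 + 2 * \<delta>) * (1 - 2 * r * \<delta>)"
    proof -
      have "2 * r * \<delta> \<le> 2 * 1 * ((1 - r) / 4)"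
        using \<delta> r by (intro mult_mono) auto
      then have "2 * r * \<delta> < 1 - r" using r by simp
      then have "0 < 2 * \<delta> * ((1 - r) - 2 * r * \<delta>)" using \<delta> by simp
      then show ?thesis by (simp add: algebra_simps)
    qed
    also have "\<dots> \<le> a\<^sup>2 * \<beta> ^ (CARD('n) - 1)"
    proof (rule mult_mono)
      show "1 + 2 * \<delta> \<le> a\<^sup>2" by (simp add: a_def power2_eq_square algebra_simps)
      have "1 - 2 * r * \<delta> = 1 + m * (- (2 * \<delta> / (P - 1)))"
        by (simp add: r_def)
      also have "\<dots> \<le> (1 + (- (2 * \<delta> / (P - 1)))) ^ (CARD('n) - 1)"
        unfolding m_def using \<beta> by (intro Bernoulli_inequality) (simp add: \<beta>_def)
      finally show "1 - 2 * r * \<delta> \<le> \<beta> ^ (CARD('n) - 1)" by (simp add: \<beta>_def)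
      show "0 \<le> 1 - 2 * r * \<delta>"
        using mult_mono[of r 1 \<delta> "1/4"] \<delta> r by auto
    qed auto
    also have "\<dots> = (det ?D)\<^sup>2"
      by (simp add: det_axial_matrix power_mult_distrib b(2)[symmetric] power_mult[symmetric] mult.commute)
    finally have "1 < (det ?D)\<^sup>2" .
    moreover have "det ?D \<ge> 0"
      using b \<delta> by (simp add: det_axial_matrix a_def)
    ultimately show "det ?D > 1"
      by (metis one_power2 power2_less_imp_less)
  qed
qed

text \<open>Both tips \<open>P e\<close> and \<open>- P e\<close> lie in \<open>S\<close>, so the
  centre can stay at the origin. The squared semi-axes \<open>1 + q * s\<close> and
  \<open>1 - s\<close>, where \<open>q = P^2 - 1\<close>, make the squared support value at
  \<open>w\<close> the average of \<open>1\<close> and \<open>(P * t)^2\<close> with weights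
  \<open>1 - s\<close> and \<open>s\<close>; it never exceeds the larger of the two. At
  \<open>s = 0\<close> the squared determinant grows at rate \<open>q - (n - 1)\<close>, which is
  positive exactly when \<open>P^2 > n\<close>.\<close>

lemma larger_ellipsoid_symmetric:
  fixes S :: "(real^'n) set"
  assumes S: "convex S" "closed S" "cball 0 1 \<subseteq> S" and p: "P *\<^sub>R axis k 1 \<in> S"
    and sym: "\<And>x. x \<in> S \<Longrightarrow> - x \<in> S"
    and P: "P > sqrt (real CARD('n))"
  obtains D where "\<And>x. norm x \<le> 1 \<Longrightarrow> D *v x \<in> S" "det D > 1"
proof -
  define m where "m = real (CARD('n) - 1)"
  have card: "CARD('n) \<ge> 1" "real CARD('n) \<ge> 1"
    by (simp_all add: Suc_leI)
  have "(sqrt (real CARD('n)))\<^sup>2 < P\<^sup>2"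
    using P by (intro power_strict_mono) auto
  then have P2: "P\<^sup>2 > real CARD('n)" by simp
  define q where "q = P\<^sup>2 - 1"
  have m: "0 \<le> m" "m < q" "q > 0"
    using P2 card by (simp_all only: m_def q_def of_nat_diff)
  \<comment> \<open>The bound 1/2 keeps \<open>b\<close> positive. The other one forces
    \<open>q * m * s < q - m\<close>, so that the quadratic term cannot consume the gain.\<close>
  define s where "s = min (1 / 2) ((q - m) / (2 * (m + 1) * q))"
  have s_le: "s \<le> 1 / 2" "s \<le> (q - m) / (2 * (m + 1) * q)"
    unfolding s_def by (rule min.cobounded1, rule min.cobounded2)
  have "0 < s" using m by (simp add: s_def)
  then have s: "0 < s" "s < 1" using s_le by auto
  define a where "a = sqrt (1 + q * s)"
  define b where "b = sqrt (1 - s)"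
  have b: "b > 0" "b\<^sup>2 = 1 - s" using s by (auto simp: b_def)
  have a: "a > 0" "a\<^sup>2 = 1 + q * s" using s m by (auto simp: a_def add_pos_pos)
  let ?D = "axial_matrix k a b"
  show ?thesis
  proof
    fix x :: "real^'n" assume x: "norm x \<le> 1"
    show "?D *v x \<in> S"
    proof (rule mem_closed_convex_support[OF S(1,2)])
      fix w :: "real^'n" assume w: "norm w = 1"
      define t where "t = w $ k"
      have le: "w \<bullet> (?D *v x) \<le> sqrt (a\<^sup>2 * t\<^sup>2 + b\<^sup>2 * (1 - t\<^sup>2))"
        using inner_axial_matrix_le[OF w x, of k a b] by (simp add: t_def)
      have eq: "a\<^sup>2 * t\<^sup>2 + b\<^sup>2 * (1 - t\<^sup>2) = (1 - s) + s * (P * t)\<^sup>2"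
        unfolding a b q_def by algebra
      show "\<exists>y\<in>S. w \<bullet> (?D *v x) \<le> w \<bullet> y"
      proof (cases "(P * t)\<^sup>2 \<le> 1")
        case True
        then have "s * (P * t)\<^sup>2 \<le> s" using s by (simp add: mult_left_le)
        then have "w \<bullet> (?D *v x) \<le> 1" using le eq
          by (smt (verit) real_sqrt_le_1_iff)
        then have "w \<bullet> (?D *v x) \<le> w \<bullet> w"
          using w by (simp add: dot_square_norm)
        moreover have "w \<in> S" using S(3) w by auto
        ultimately show ?thesis by blast
      next
        case False
        then have "(1 - s) * 1 \<le> (1 - s) * (P * t)\<^sup>2" using s by (intro mult_left_mono) auto
        then have "a\<^sup>2 * t\<^sup>2 + b\<^sup>2 * (1 - t\<^sup>2) \<le> (P * t)\<^sup>2"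
          unfolding eq by (simp add: algebra_simps)
        then have "w \<bullet> (?D *v x) \<le> \<bar>P * t\<bar>"
          using le real_sqrt_le_mono by fastforce
        also have "P * t = w \<bullet> (P *\<^sub>R axis k 1)"
          by (simp add: inner_axis t_def)
        finally have "w \<bullet> (?D *v x) \<le> w \<bullet> (P *\<^sub>R axis k 1) \<or> w \<bullet> (?D *v x) \<le> w \<bullet> (- (P *\<^sub>R axis k 1))"
          by (auto simp: abs_real_def split: if_splits)
        then show ?thesis using p sym by blast
      qed
    qed
  next
    have "1 < (1 + q * s) * (1 - m * s)"
    proof -
      have "q * m * s \<le> q * m * ((q - m) / (2 * (m + 1) * q))"
        using m s_le by (intro mult_left_mono) auto
      also have "\<dots> = (m / (m + 1)) * ((q - m) / 2)"
        using m by (simp add: divide_simps)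
      also have "\<dots> \<le> 1 * ((q - m) / 2)"
        using m by (intro mult_right_mono) auto
      also have "\<dots> < q - m" using m by simp
      finally have "0 < s * ((q - m) - q * m * s)" using s by simp
      then show ?thesis by (simp add: algebra_simps)
    qed
    also have "\<dots> \<le> a\<^sup>2 * (1 - s) ^ (CARD('n) - 1)"
      unfolding a(2)
    proof (rule mult_left_mono)
      have "1 - m * s = 1 + m * (- s)" by simp
      also have "\<dots> \<le> (1 + (- s)) ^ (CARD('n) - 1)"
        unfolding m_def using s by (intro Bernoulli_inequality) simp
      finally show "1 - m * s \<le> (1 - s) ^ (CARD('n) - 1)" by simp
      show "0 \<le> 1 + q * s" using m s by simp
    qed
    also have "\<dots> = (det ?D)\<^sup>2"
      by (simp add: det_axial_matrix power_mult_distrib b(2)[symmetric] power_mult[symmetric] mult.commute)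
    finally have "1 < (det ?D)\<^sup>2" .
    moreover have "det ?D \<ge> 0"
      using b a by (simp add: det_axial_matrix)
    ultimately show "det ?D > 1"
      by (metis one_power2 power2_less_imp_less)
  qed
qed

section \<open>Inscribed ellipsoids of maximal volume\<close>

lemma continuous_on_det [continuous_intros]:
  fixes f :: "'a::topological_space \<Rightarrow> real^'n^'n"
  assumes "continuous_on S f"
  shows "continuous_on S (\<lambda>x. det (f x))"
  unfolding det_def by (intro continuous_intros assms)

lemma continuous_on_matrix_vector_mult [continuous_intros]:
  fixes f :: "'a::topological_space \<Rightarrow> real^'n^'m"
  assumes "continuous_on S f" "continuous_on S g"
  shows "continuous_on S (\<lambda>x. f x *v g x)"
  unfolding matrix_vector_mult_def by (intro continuous_intros assms)

definition inscribed :: "(real^'n) set \<Rightarrow> real^'n^'n \<Rightarrow> real^'n \<Rightarrow> bool" where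
  "inscribed K T c \<longleftrightarrow> (\<forall>x. norm x \<le> 1 \<longrightarrow> c + T *v x \<in> K)"

lemma inscribedD: "inscribed K T c \<Longrightarrow> norm x \<le> 1 \<Longrightarrow> c + T *v x \<in> K"
  by (simp add: inscribed_def)

text \<open>Closed as an intersection of preimages over the points of the unit ball; bounded because
  each column of the matrix is a difference of two points of \<open>K\<close>. The set
  \<open>C\<close> restricts the centre, which must be the origin in the symmetric case.\<close>

lemma compact_inscribed:
  fixes K :: "(real^'n) set"
  assumes K: "compact K" and C: "closed C"
  shows "compact {p. snd p \<in> C \<and> inscribed K (fst p) (snd p)}" (is "compact ?F")
proof -
  have eq: "?F = (snd -` C) \<inter> (\<Inter>x\<in>cball 0 1. (\<lambda>p. snd p + fst p *v x) -` K)"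
    by (auto simp: inscribed_def)
  have cl: "closed ((\<lambda>p::(real^'n^'n) \<times> (real^'n). snd p + fst p *v x) -` K)" for x
    using compact_imp_closed[OF K] by (intro closed_vimage continuous_intros)
  moreover have "closed (snd -` C :: ((real^'n^'n) \<times> (real^'n)) set)"
    using C by (intro closed_vimage continuous_intros)
  ultimately have "closed ?F" unfolding eq using cl by (intro closed_Int closed_INT ballI)
  moreover have "bounded ?F"
  proof -
    obtain R where R: "\<And>x. x \<in> K \<Longrightarrow> norm x \<le> R"
      using compact_imp_bounded[OF K] bounded_iff by metis
    have "norm (fst p) \<le> (\<Sum>i\<in>(UNIV::'n set). \<Sum>j\<in>(UNIV::'n set). 2 * R) \<and> norm (snd p) \<le> R"
      if p: "p \<in> ?F" for p
    proof
      have in_K: "snd p + fst p *v x \<in> K" if "norm x \<le> 1" for x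
        using p that by (simp add: inscribed_def)
      show c: "norm (snd p) \<le> R" using R[OF in_K[of 0]] by simp
      have comp: "\<bar>fst p $ i $ j\<bar> \<le> 2 * R" for i j
      proof -
        have "fst p $ i $ j = (fst p *v axis j 1) $ i"
          by (simp add: matrix_vector_mul_component inner_axis)
        then have "\<bar>fst p $ i $ j\<bar> \<le> norm (fst p *v axis j 1)"
          by (simp add: component_le_norm_cart)
        also have "\<dots> = norm ((snd p + fst p *v axis j 1) - snd p)" by simp
        also have "\<dots> \<le> R + R"
          using R[OF in_K[of "axis j 1"]] c by (intro norm_triangle_le_diff) auto
        finally show ?thesis by simp
      qed
      have "norm (fst p) \<le> (\<Sum>i\<in>UNIV. norm (fst p $ i))"
        unfolding norm_vec_def[of "fst p"] by (intro L2_set_le_sum) auto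
      also have "\<dots> \<le> (\<Sum>i\<in>UNIV. \<Sum>j\<in>UNIV. \<bar>fst p $ i $ j\<bar>)"
        by (intro sum_mono norm_le_l1_cart)
      also have "\<dots> \<le> (\<Sum>i\<in>(UNIV::'n set). \<Sum>j\<in>(UNIV::'n set). 2 * R)"
        by (intro sum_mono comp)
      finally show "norm (fst p) \<le> \<dots>" .
    qed
    then have "?F \<subseteq> cball 0 (\<Sum>i\<in>(UNIV::'n set). \<Sum>j\<in>(UNIV::'n set). 2 * R) \<times> cball 0 R"
      by (auto simp: mem_Times_iff)
    then show ?thesis
      by (rule bounded_subset[rotated]) (intro bounded_Times bounded_cball)
  qed
  ultimately show ?thesis by (simp add: compact_eq_bounded_closed)
qed

text \<open>\<open>\<bar>det T\<bar>\<close> is the volume up to a constant factor, and it is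
  continuous on a compact set of pairs. The ball inside \<open>K\<close> makes the maximum
  positive.\<close>

lemma maximal_inscribed:
  fixes K :: "(real^'n) set"
  assumes K: "compact K" and C: "closed C" and a: "a \<in> C" "\<epsilon> > 0" "cball a \<epsilon> \<subseteq> K"
  obtains T c where "c \<in> C" "inscribed K T c" "det T \<noteq> 0"
    "\<And>T' c'. c' \<in> C \<Longrightarrow> inscribed K T' c' \<Longrightarrow> \<bar>det T'\<bar> \<le> \<bar>det T\<bar>"
proof -
  let ?F = "{p. snd p \<in> C \<and> inscribed K (fst p) (snd p)}"
  have "inscribed K (\<epsilon> *\<^sub>R mat 1) a"
    unfolding inscribed_def
  proof (intro allI impI)
    fix x :: "real^'n" assume "norm x \<le> 1"
    then have "a + (\<epsilon> *\<^sub>R mat 1) *v x \<in> cball a \<epsilon>"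
      using a by (simp add: scaleR_matrix_vector_assoc[symmetric] dist_norm mult_left_le)
    then show "a + (\<epsilon> *\<^sub>R mat 1) *v x \<in> K" using a by blast
  qed
  then have F: "(\<epsilon> *\<^sub>R mat 1, a) \<in> ?F" using a by simp
  have "continuous_on ?F (\<lambda>p. \<bar>det (fst p)\<bar>)" by (intro continuous_intros)
  then obtain p where p: "p \<in> ?F" "\<And>q. q \<in> ?F \<Longrightarrow> \<bar>det (fst q)\<bar> \<le> \<bar>det (fst p)\<bar>"
    using continuous_attains_sup[OF compact_inscribed[OF K C]] F by blast
  have "det (\<epsilon> *\<^sub>R mat 1 :: real^'n^'n) > 0"
    using a by (subst det_diagonal) (auto simp: mat_def)
  with p(2)[OF F] have "det (fst p) \<noteq> 0" by auto
  show ?thesis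
    using p \<open>det (fst p) \<noteq> 0\<close> by (intro that[of "snd p" "fst p"]) auto
qed

text \<open>Composing \<open>T\<close> with an orthogonal map changes neither the ellipsoid nor its
  volume. A far point can thus be put on a coordinate axis, the position that the enlargement of the
  unit ball requires.\<close>

lemma inscribed_rotate:
  fixes K :: "(real^'n) set"
  assumes ins: "inscribed K T c" and q: "c + T *v q \<in> K" "q \<noteq> 0"
  obtains T' where "\<bar>det T'\<bar> = \<bar>det T\<bar>" "inscribed K T' c" "c + T' *v (norm q *\<^sub>R axis k 1) \<in> K"
proof -
  have "norm (axis k 1 :: real^'n) = 1" "norm (q /\<^sub>R norm q) = 1" using q by simp_all
  then obtain f :: "real^'n \<Rightarrow> real^'n" where f: "orthogonal_transformation f" "f (axis k 1) = q /\<^sub>R norm q"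
    by (rule orthogonal_transformation_exists_1)
  have lin: "linear f" using f(1) by (rule orthogonal_transformation_linear)
  have mul: "(T ** matrix f) *v x = T *v f x" for x
    by (simp add: matrix_vector_mul_assoc[symmetric] matrix_works lin)
  show ?thesis
  proof (rule that[of "T ** matrix f"])
    have "\<bar>det (matrix f)\<bar> = 1"
      using f(1) det_orthogonal_matrix[of "matrix f"] orthogonal_transformation_matrix by fastforce
    then show "\<bar>det (T ** matrix f)\<bar> = \<bar>det T\<bar>" by (simp add: det_mul abs_mult)
    show "inscribed K (T ** matrix f) c"
      using ins f(1) unfolding inscribed_def mul by (simp add: orthogonal_transformation_norm)
    have "f (norm q *\<^sub>R axis k 1) = q"
      using f(2) q(2) lin by (simp add: linear_scale)
    then show "c + (T ** matrix f) *v (norm q *\<^sub>R axis k 1) \<in> K"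
      using q(1) by (simp only: mul)
  qed
qed

text \<open>Take an inscribed ellipsoid of maximal volume and pull \<open>K\<close> back so that it
  becomes the unit ball. A point of the pulled-back body with norm above \<kappa> would admit an
  ellipsoid of determinant above 1, and mapping this one forward would contradict
  maximality.\<close>

lemma john_vec_interior:
  fixes K :: "(real^'n) set"
  assumes K: "compact K" "convex K" and a: "\<epsilon> > 0" "cball a \<epsilon> \<subseteq> K"
    and \<kappa>: "\<kappa> = real CARD('n) \<or> \<kappa> = sqrt (real CARD('n)) \<and> (\<forall>x\<in>K. - x \<in> K)"
  obtains T c where "inscribed K T c" "\<And>y. y \<in> K \<Longrightarrow> \<exists>q. norm q \<le> \<kappa> \<and> y = c + T *v q"
proof -
  \<comment> \<open>For symmetric \<open>K\<close> only ellipsoids centred at the origin compete.\<close>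
  define sym where "sym = (\<kappa> \<noteq> real CARD('n))"
  define C where "C = (if sym then {0} else UNIV :: (real^'n) set)"
  have "closed C" by (simp add: C_def)
  have K_sym: "- x \<in> K" if "sym" "x \<in> K" for x
    using that \<kappa> by (auto simp: sym_def)
  obtain b where b: "b \<in> C" "cball b \<epsilon> \<subseteq> K"
  proof (cases sym)
    case True
    \<comment> \<open>Only the origin is allowed as a centre here, so a ball around it is needed:
      \<open>x\<close> is the midpoint of \<open>a + x\<close> and the reflection of
      \<open>a - x\<close>.\<close>
    have "cball 0 \<epsilon> \<subseteq> K"
    proof
      fix x :: "real^'n" assume "x \<in> cball 0 \<epsilon>"
      then have "a + x \<in> K" "a - x \<in> K" using a by (auto simp: dist_norm)
      then have "(1/2) *\<^sub>R (a + x) + (1/2) *\<^sub>R (- (a - x)) \<in> K"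
        by (intro convexD[OF K(2)] K_sym[OF True]) auto
      moreover have "(1/2) *\<^sub>R (a + x) + (1/2) *\<^sub>R (- (a - x)) = x"
        by (simp add: vec_eq_iff field_simps)
      ultimately show "x \<in> K" by simp
    qed
    then show thesis using that True by (auto simp: C_def)
  next
    case False
    then show thesis using that a by (auto simp: C_def)
  qed
  obtain T c where T: "c \<in> C" "inscribed K T c" "det T \<noteq> 0"
    "\<And>T' c'. c' \<in> C \<Longrightarrow> inscribed K T' c' \<Longrightarrow> \<bar>det T'\<bar> \<le> \<bar>det T\<bar>"
    using maximal_inscribed[OF K(1) \<open>closed C\<close> b(1) a(1) b(2)] by metis
  have small: "norm q \<le> \<kappa>" if q: "c + T *v q \<in> K" for q
  proof (rule ccontr)
    assume big: "\<not> norm q \<le> \<kappa>"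
    have "\<kappa> \<ge> 0" using \<kappa> by auto
    then have "q \<noteq> 0" using big by auto
    obtain k :: 'n where True by simp
    obtain T1 where T1: "\<bar>det T1\<bar> = \<bar>det T\<bar>" "inscribed K T1 c" "c + T1 *v (norm q *\<^sub>R axis k 1) \<in> K"
      using inscribed_rotate[OF T(2) q \<open>q \<noteq> 0\<close>] by metis
    define S where "S = {x. c + T1 *v x \<in> K}"
    have "convex S"
    proof (rule convexI)
      fix x y and u v :: real
      assume *: "x \<in> S" "y \<in> S" "0 \<le> u" "0 \<le> v" "u + v = 1"
      then have "u *\<^sub>R (c + T1 *v x) + v *\<^sub>R (c + T1 *v y) \<in> K"
        by (intro convexD[OF K(2)]) (auto simp: S_def)
      also have "u *\<^sub>R (c + T1 *v x) + v *\<^sub>R (c + T1 *v y) = (u + v) *\<^sub>R c + T1 *v (u *\<^sub>R x + v *\<^sub>R y)"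
        by (simp add: algebra_simps matrix_vector_mult_scaleR)
      finally show "u *\<^sub>R x + v *\<^sub>R y \<in> S" using * by (simp add: S_def)
    qed
    have "closed ((\<lambda>x. c + T1 *v x) -` K)"
      using compact_imp_closed[OF K(1)] by (intro closed_vimage continuous_intros)
    then have "closed S" by (simp add: S_def vimage_def)
    have "cball 0 1 \<subseteq> S" using T1(2) by (auto simp: S_def inscribed_def)
    have "norm q *\<^sub>R axis k 1 \<in> S" using T1(3) by (simp add: S_def)
    note S = \<open>convex S\<close> \<open>closed S\<close> \<open>cball 0 1 \<subseteq> S\<close> this
    have "\<exists>D d. (\<forall>x. norm x \<le> 1 \<longrightarrow> d + D *v x \<in> S) \<and> det D > 1 \<and> c + T1 *v d \<in> C"
    proof (cases sym)
      case True
      then have "c = 0" using T(1) by (simp add: C_def)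
      then have "\<And>x. x \<in> S \<Longrightarrow> - x \<in> S"
        using K_sym[OF True] by (simp add: S_def linear_neg[OF matrix_vector_mul_linear])
      moreover have "norm q > sqrt (real CARD('n))" using True \<kappa> big by (auto simp: sym_def)
      ultimately obtain D where "\<And>x. norm x \<le> 1 \<Longrightarrow> D *v x \<in> S" "det D > 1"
        using larger_ellipsoid_symmetric[OF S] by metis
      then show ?thesis
        using True \<open>c = 0\<close> by (intro exI[of _ D] exI[of _ 0]) (simp add: C_def)
    next
      case False
      then have "norm q > real CARD('n)" using big by (auto simp: sym_def)
      then show ?thesis
        using larger_ellipsoid[OF S] False unfolding C_def by (metis UNIV_I)
    qed
    then obtain D d where D: "\<And>x. norm x \<le> 1 \<Longrightarrow> d + D *v x \<in> S" "det D > 1" "c + T1 *v d \<in> C"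
      by blast
    have "inscribed K (T1 ** D) (c + T1 *v d)"
      using D(1) by (simp add: inscribed_def S_def matrix_vector_mul_assoc[symmetric] algebra_simps)
    from T(4)[OF D(3) this] have "\<bar>det T\<bar> * det D \<le> \<bar>det T\<bar> * 1"
      using T1(1) D(2) by (simp add: det_mul abs_mult)
    then show False using D(2) T(3) by simp
  qed
  show thesis
  proof (rule that[OF T(2)])
    fix y assume "y \<in> K"
    obtain T' where "T ** T' = mat 1"
      using T(3) invertible_det_nz[of T] invertible_def by blast
    then have "y = c + T *v (T' *v (y - c))"
      by (simp add: matrix_vector_mul_assoc)
    then show "\<exists>q. norm q \<le> \<kappa> \<and> y = c + T *v q"
      using small \<open>y \<in> K\<close> by metis
  qed
qed

text \<open>
  If \<open>K\<close> has empty interior, there is no inscribed ellipsoid of maximal positive volume; take a limit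
  of ellipsoids for the parallel bodies of \<open>K\<close>, which may degenerate.
\<close>
lemma john_vec:
  fixes K :: "(real^'n) set"
  assumes K: "compact K" "convex K" "K \<noteq> {}"
    and \<kappa>: "\<kappa> = real CARD('n) \<or> \<kappa> = sqrt (real CARD('n)) \<and> (\<forall>x\<in>K. - x \<in> K)"
  obtains T c where "inscribed K T c" "\<And>y. y \<in> K \<Longrightarrow> \<exists>q. norm q \<le> \<kappa> \<and> y = c + T *v q"
proof -
  define \<epsilon> where "\<epsilon> k = inverse (real (Suc k))" for k
  have \<epsilon>: "0 < \<epsilon> k" "\<epsilon> k \<le> 1" for k by (auto simp: \<epsilon>_def inverse_le_1_iff)
  have \<epsilon>_lim: "\<epsilon> \<longlonglongrightarrow> 0" unfolding \<epsilon>_def by (rule LIMSEQ_inverse_real_of_nat)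
  define E where "E r = (\<Union>x\<in>K. \<Union>y\<in>cball 0 r. {x + y})" for r :: real
  have "\<exists>T c. inscribed (E (\<epsilon> k)) T c \<and> (\<forall>y\<in>E (\<epsilon> k). \<exists>q. norm q \<le> \<kappa> \<and> y = c + T *v q)" for k
  proof -
    have "compact (E (\<epsilon> k))" unfolding E_def by (intro compact_sums' K) auto
    moreover have "convex (E (\<epsilon> k))"
      unfolding E_def by (intro convex_sums K convex_cball)
    moreover obtain a where "a \<in> K" using K by blast
    then have "cball a (\<epsilon> k) \<subseteq> E (\<epsilon> k)"
    proof (intro subsetI)
      fix x assume "x \<in> cball a (\<epsilon> k)"
      then have "x = a + (x - a)" "x - a \<in> cball 0 (\<epsilon> k)" by (auto simp: dist_norm norm_minus_commute)
      then show "x \<in> E (\<epsilon> k)" using \<open>a \<in> K\<close> unfolding E_def by blast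
    qed
    moreover have "\<kappa> = real CARD('n) \<or> \<kappa> = sqrt (real CARD('n)) \<and> (\<forall>x\<in>E (\<epsilon> k). - x \<in> E (\<epsilon> k))"
    proof -
      have "\<forall>x\<in>E (\<epsilon> k). - x \<in> E (\<epsilon> k)" if "\<forall>x\<in>K. - x \<in> K"
      proof
        fix z assume "z \<in> E (\<epsilon> k)"
        then obtain x y where "z = x + y" "x \<in> K" "y \<in> cball 0 (\<epsilon> k)" unfolding E_def by blast
        then have "- z = - x + - y" "- x \<in> K" "- y \<in> cball 0 (\<epsilon> k)" using that by auto
        then show "- z \<in> E (\<epsilon> k)" unfolding E_def by blast
      qed
      then show ?thesis using \<kappa> by blast
    qed
    ultimately obtain T c where "inscribed (E (\<epsilon> k)) T c"
        "\<And>y. y \<in> E (\<epsilon> k) \<Longrightarrow> \<exists>q. norm q \<le> \<kappa> \<and> y = c + T *v q"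
      using john_vec_interior[OF _ _ \<epsilon>(1)] by metis
    then show ?thesis by blast
  qed
  then obtain T c where Tc: "\<And>k. inscribed (E (\<epsilon> k)) (T k) (c k)"
    "\<And>k y. y \<in> E (\<epsilon> k) \<Longrightarrow> \<exists>q. norm q \<le> \<kappa> \<and> y = c k + T k *v q"
    by metis
  \<comment> \<open>As \<open>\<epsilon> k \<le> 1\<close>, all the pairs \<open>(T k, c k)\<close>
    lie in this one compact set.\<close>
  let ?F = "{p. snd p \<in> UNIV \<and> inscribed (E 1) (fst p) (snd p)}"
  have "compact (E 1)" unfolding E_def by (intro compact_sums' K) auto
  then have "compact ?F" by (rule compact_inscribed) simp
  moreover have "(T k, c k) \<in> ?F" for k
  proof -
    have "E (\<epsilon> k) \<subseteq> E 1"
      unfolding E_def using subset_cball[OF \<epsilon>(2)] by blast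
    then show ?thesis using Tc(1) by (auto simp: inscribed_def)
  qed
  ultimately obtain p r where r: "strict_mono r" and lim: "((\<lambda>k. (T k, c k)) \<circ> r) \<longlonglongrightarrow> p"
    using compact_def[of ?F] by (metis (no_types, lifting))
  have T_lim: "(\<lambda>k. T (r k)) \<longlonglongrightarrow> fst p" and c_lim: "(\<lambda>k. c (r k)) \<longlonglongrightarrow> snd p"
    using tendsto_fst[OF lim] tendsto_snd[OF lim] by (simp_all add: o_def)
  have mult_lim: "(\<lambda>k. A k *v x k) \<longlonglongrightarrow> A' *v x'"
    if "A \<longlonglongrightarrow> A'" "x \<longlonglongrightarrow> x'" for A :: "nat \<Rightarrow> real^'n^'n" and A' x x'
    unfolding matrix_vector_mult_def using that by (intro tendsto_intros)
  show thesis
  proof (rule that[of "fst p" "snd p"])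
    show "inscribed K (fst p) (snd p)"
      unfolding inscribed_def
    proof (intro allI impI)
      fix x :: "real^'n" assume x: "norm x \<le> 1"
      let ?z = "\<lambda>k. c (r k) + T (r k) *v x"
      have "?z \<longlonglongrightarrow> snd p + fst p *v x"
        by (intro tendsto_add c_lim mult_lim T_lim tendsto_const)
      then have "(\<lambda>k. infdist (?z k) K) \<longlonglongrightarrow> infdist (snd p + fst p *v x) K"
        by (rule tendsto_infdist)
      moreover have "(\<lambda>k. infdist (?z k) K) \<longlonglongrightarrow> 0"
      proof (rule tendsto_sandwich[OF _ _ tendsto_const])
        show "(\<lambda>k. \<epsilon> (r k)) \<longlonglongrightarrow> 0"
          using LIMSEQ_subseq_LIMSEQ[OF \<epsilon>_lim r] by (simp add: o_def)
        have "infdist (?z k) K \<le> \<epsilon> (r k)" for k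
        proof -
          obtain u v where "?z k = u + v" "u \<in> K" "v \<in> cball 0 (\<epsilon> (r k))"
            using inscribedD[OF Tc(1) x] unfolding E_def by blast
          then show ?thesis using infdist_le2[of u K "?z k" "\<epsilon> (r k)"] by (simp add: dist_norm)
        qed
        then show "\<forall>\<^sub>F k in sequentially. infdist (?z k) K \<le> \<epsilon> (r k)" by simp
      qed (simp add: infdist_nonneg)
      ultimately have "infdist (snd p + fst p *v x) K = 0"
        using LIMSEQ_unique by blast
      then show "snd p + fst p *v x \<in> K"
        using in_closed_iff_infdist_zero[OF compact_imp_closed[OF K(1)] K(3)] by blast
    qed
  next
    fix y assume "y \<in> K"
    have "y \<in> E (\<epsilon> k)" for k
      using \<open>y \<in> K\<close> \<epsilon>(1)[of k] unfolding E_def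
      by (intro UN_I[of y] UN_I[of 0]) (auto intro: less_imp_le)
    then have "\<exists>q. q \<in> cball 0 \<kappa> \<and> y = c k + T k *v q" for k
      using Tc(2)[of y k] by auto
    then obtain q where q: "\<And>k. q k \<in> cball 0 \<kappa>" "\<And>k. y = c k + T k *v q k"
      by metis
    \<comment> \<open>The points \<open>q k\<close> depend on \<open>y\<close>, so a further
      subsequence is extracted for each \<open>y\<close>; the limits of \<open>T\<close> and
      \<open>c\<close> are already fixed.\<close>
    have "compact (cball (0::real^'n) \<kappa>)" by simp
    moreover have "\<forall>k. (q \<circ> r) k \<in> cball 0 \<kappa>" using q(1) by simp
    ultimately obtain q' s where s: "q' \<in> cball 0 \<kappa>" "strict_mono s" "((q \<circ> r) \<circ> s) \<longlonglongrightarrow> q'"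
      unfolding compact_def by blast
    have "(\<lambda>k. c (r (s k)) + T (r (s k)) *v q (r (s k))) \<longlonglongrightarrow> snd p + fst p *v q'"
      using LIMSEQ_subseq_LIMSEQ[OF c_lim s(2)] LIMSEQ_subseq_LIMSEQ[OF T_lim s(2)] s(3)
      by (intro tendsto_add mult_lim) (simp_all add: o_def)
    then have "(\<lambda>k. y) \<longlonglongrightarrow> snd p + fst p *v q'"
      by (simp add: q(2)[symmetric])
    then have "y = snd p + fst p *v q'"
      by (simp add: LIMSEQ_const_iff)
    then show "\<exists>q. norm q \<le> \<kappa> \<and> y = snd p + fst p *v q"
      using s(1) by auto
  qed
qed

text \<open>
  An index type of cardinality \<open>DIM('a)\<close>, so that determinants of matrices indexed by it become
  available for an arbitrary Euclidean space.
\<close>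
typedef (overloaded) ('a::euclidean_space) basis_index = "Basis :: 'a set"
  using nonempty_Basis by blast

instance basis_index :: (euclidean_space) finite
  by standard (metis Abs_basis_index_cases finite_Basis finite_imageI finite_subset image_eqI subsetI)

lemma card_basis_index: "CARD('a::euclidean_space basis_index) = DIM('a)"
  by (rule type_definition.card[OF type_definition_basis_index])

text \<open>A linear isometry onto the coordinate space preserves the unit ball and its
  \<kappa>-dilate. For flat \<open>K\<close> the map \<open>T\<close> is necessarily
  singular.\<close>

lemma john:
  fixes K :: "'a::euclidean_space set"
  assumes K: "compact K" "convex K" "K \<noteq> {}"
    and \<kappa>: "\<kappa> = real DIM('a) \<or> \<kappa> = sqrt (real DIM('a)) \<and> (\<forall>x\<in>K. - x \<in> K)"
  obtains T :: "'a \<Rightarrow> 'a" and c where "linear T" "\<And>x. norm x \<le> 1 \<Longrightarrow> c + T x \<in> K"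
    "\<And>y. y \<in> K \<Longrightarrow> \<exists>q. norm q \<le> \<kappa> \<and> y = c + T q"
proof -
  have "DIM('a) = DIM(real^'a basis_index)" by (simp add: card_basis_index)
  then obtain f :: "'a \<Rightarrow> real^'a basis_index" and g where fg: "linear f" "linear g"
      "\<And>x. norm (f x) = norm x" "\<And>y. norm (g y) = norm y" "\<And>x. g (f x) = x" "\<And>y. f (g y) = y"
    by (rule isomorphisms_UNIV_UNIV) blast
  have "compact (f ` K)" using fg(1) K(1) by (intro compact_continuous_image linear_continuous_on) (simp_all add: linear_linear)
  moreover have "convex (f ` K)" using fg(1) K(2) by (rule convex_linear_image)
  moreover have "f ` K \<noteq> {}" using K(3) by simp
  moreover have "\<kappa> = real CARD('a basis_index) \<or>
      \<kappa> = sqrt (real CARD('a basis_index)) \<and> (\<forall>x\<in>f ` K. - x \<in> f ` K)"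
    using \<kappa> unfolding card_basis_index by (auto simp: linear_neg[OF fg(1), symmetric])
  ultimately obtain T c where T: "inscribed (f ` K) T c"
      "\<And>y. y \<in> f ` K \<Longrightarrow> \<exists>q. norm q \<le> \<kappa> \<and> y = c + T *v q"
    using john_vec by metis
  show thesis
  proof (rule that[of "\<lambda>x. g (T *v f x)" "g c"])
    show "linear (\<lambda>x. g (T *v f x))"
      using linear_compose[OF linear_compose[OF fg(1) matrix_vector_mul_linear] fg(2)] by (simp add: o_def)
    fix x :: 'a assume "norm x \<le> 1"
    then have "c + T *v f x \<in> f ` K" using T(1) fg(3) by (simp add: inscribed_def)
    then have "g (c + T *v f x) \<in> K" using fg(5) by auto
    then show "g c + g (T *v f x) \<in> K" by (simp add: linear_add[OF fg(2)])
  next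
    fix y assume "y \<in> K"
    then obtain q where q: "norm q \<le> \<kappa>" "f y = c + T *v q" using T(2) by blast
    have "y = g (c + T *v q)" using q(2) fg(5) by metis
    then have "y = g c + g (T *v f (g q))" by (simp add: linear_add[OF fg(2)] fg(6))
    then show "\<exists>q. norm q \<le> \<kappa> \<and> y = g c + g (T *v f q)" using q(1) fg(4) by metis
  qed
qed

section \<open>Singular values\<close>

text \<open>
  First variation of \<open>norm (A z)\<close> at a maximizer: it makes the greedy choice of singular vectors work.
\<close>
lemma maximal_image_orthogonal:
  fixes A :: "'a::euclidean_space \<Rightarrow> 'b::euclidean_space"
  assumes A: "linear A" and V: "subspace V" "x \<in> V" "y \<in> V"
    and max: "\<And>z. z \<in> V \<Longrightarrow> norm (A z) \<le> s * norm z" and x: "norm x = 1" "norm (A x) = s"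
    and xy: "x \<bullet> y = 0"
  shows "A x \<bullet> A y = 0"
proof (rule ccontr)
  assume ne: "A x \<bullet> A y \<noteq> 0"
  define c where "c = A x \<bullet> A y"
  have s: "s \<ge> 0" using x by auto
  have xx: "x \<bullet> x = 1" and yx: "y \<bullet> x = 0"
    using x(1) xy by (simp_all add: norm_eq_1 inner_commute)
  have *: "2 * t * c \<le> t\<^sup>2 * (s\<^sup>2 * (norm y)\<^sup>2)" for t
  proof -
    have "x + t *\<^sub>R y \<in> V" using V by (simp add: subspace_add subspace_scale)
    then have 1: "(norm (A (x + t *\<^sub>R y)))\<^sup>2 \<le> (s * norm (x + t *\<^sub>R y))\<^sup>2"
      by (intro power_mono max) auto
    have 2: "(norm (x + t *\<^sub>R y))\<^sup>2 = 1 + t\<^sup>2 * (norm y)\<^sup>2"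
      using xx xy yx by (simp add: power2_norm_eq_inner inner_add_left inner_add_right)
        (simp add: power2_eq_square)
    have 3: "(norm (A (x + t *\<^sub>R y)))\<^sup>2 = s\<^sup>2 + 2 * t * c + t\<^sup>2 * (norm (A y))\<^sup>2"
      unfolding x(2)[symmetric] c_def
      by (simp add: linear_add[OF A] linear_scale[OF A] power2_norm_eq_inner inner_add_left inner_add_right
          inner_commute[of "A y" "A x"]) (simp add: power2_eq_square algebra_simps)
    have "s\<^sup>2 + 2 * t * c + t\<^sup>2 * (norm (A y))\<^sup>2 \<le> s\<^sup>2 * (1 + t\<^sup>2 * (norm y)\<^sup>2)"
      using 1 unfolding 3 power_mult_distrib 2 .
    moreover have "0 \<le> t\<^sup>2 * (norm (A y))\<^sup>2" by simp
    moreover have "s\<^sup>2 * (1 + t\<^sup>2 * (norm y)\<^sup>2) = s\<^sup>2 + t\<^sup>2 * (s\<^sup>2 * (norm y)\<^sup>2)"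
      by (simp add: algebra_simps)
    ultimately show ?thesis by linarith
  qed
  \<comment> \<open>For nonzero \<open>c\<close> the inequality fails at small \<open>t\<close> of
    the same sign as \<open>c\<close>, and \<open>c / M\<close> is such a value. The added 1 keeps
    \<open>M\<close> positive even if \<open>y\<close> or \<open>s\<close> vanishes.\<close>
  define M where "M = s\<^sup>2 * (norm y)\<^sup>2 + 1"
  have M: "M > 0" unfolding M_def by (simp add: add_nonneg_pos)
  have "2 * (c / M) * c \<le> (c / M)\<^sup>2 * (M - 1)" using *[of "c / M"] by (simp add: M_def)
  also have "\<dots> \<le> (c / M)\<^sup>2 * M" by (intro mult_left_mono) auto
  finally have "2 * c\<^sup>2 \<le> c\<^sup>2" using M by (simp add: power2_eq_square field_simps)
  then show False using ne by (simp add: c_def)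
qed

text \<open>Choose a unit vector of \<open>V\<close> that \<open>A\<close> stretches most and
  continue in its orthogonal complement within \<open>V\<close>; the induction therefore ranges over
  all subspaces. The maximum over a smaller space is no larger, hence the decreasing order. The last
  clause is the orthonormal expansion, ready for substitution into sums.\<close>

lemma singular_value_basis:
  fixes A :: "'a::euclidean_space \<Rightarrow> 'b::euclidean_space"
  assumes A: "linear A" and "subspace V" and "dim V = k"
  shows "\<exists>x. (\<forall>j<k. x j \<in> V \<and> norm (x j) = 1) \<and>
    (\<forall>j<k. \<forall>l<k. j \<noteq> l \<longrightarrow> x j \<bullet> x l = 0 \<and> A (x j) \<bullet> A (x l) = 0) \<and>
    (\<forall>l<k. \<forall>j\<le>l. norm (A (x l)) \<le> norm (A (x j))) \<and>
    (\<forall>y\<in>V. y = (\<Sum>j<k. (y \<bullet> x j) *\<^sub>R x j))"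
  using assms(2,3)
proof (induction k arbitrary: V)
  case 0
  then have "V \<subseteq> {0}" by (simp add: dim_eq_0)
  then show ?case by auto
next
  case (Suc k)
  let ?U = "V \<inter> sphere 0 1"
  have "V \<noteq> {0}" using Suc.prems by force
  then obtain v where v: "v \<in> V" "v \<noteq> 0" using subspace_0[OF Suc.prems(1)] by auto
  then have "v /\<^sub>R norm v \<in> ?U" using Suc.prems by (simp add: subspace_scale)
  then have "?U \<noteq> {}" by blast
  moreover have "compact ?U"
    using closed_subspace[OF Suc.prems(1)] by (intro closed_Int_compact) auto
  moreover have "continuous_on ?U (\<lambda>x. norm (A x))"
    using A by (intro continuous_intros linear_continuous_on) (simp add: linear_linear)
  ultimately obtain x0 where x0: "x0 \<in> ?U" "\<And>z. z \<in> ?U \<Longrightarrow> norm (A z) \<le> norm (A x0)"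
    using continuous_attains_sup by (metis (no_types, lifting))
  have x0V: "x0 \<in> V" "norm x0 = 1" using x0 by auto
  have max: "norm (A z) \<le> norm (A x0) * norm z" if "z \<in> V" for z
  proof (cases "z = 0")
    case True then show ?thesis using A by (simp add: linear_0)
  next
    case False
    then have "z /\<^sub>R norm z \<in> ?U" using Suc.prems that by (simp add: subspace_scale)
    then have "norm (A (z /\<^sub>R norm z)) \<le> norm (A x0)" by (rule x0)
    then show ?thesis using False by (simp add: linear_scale[OF A] field_simps)
  qed
  define W where "W = {y \<in> V. \<forall>x \<in> span {x0}. orthogonal x y}"
  have Weq: "W = {y \<in> V. x0 \<bullet> y = 0}"
    by (auto simp: W_def span_singleton orthogonal_def)
  have "subspace W"
    using Suc.prems(1) unfolding Weq subspace_def by (auto simp: inner_add_right)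
  have "dim W + dim (span {x0}) = dim V"
    unfolding W_def
  proof (rule dim_subspace_orthogonal_to_vectors[OF subspace_span Suc.prems(1)])
    show "span {x0} \<subseteq> V" using x0V Suc.prems(1) by (intro span_minimal) auto
  qed
  moreover have "dim (span {x0}) = 1"
  proof -
    have "x0 \<noteq> 0" using x0V by auto
    then show ?thesis by (simp add: dim_insert)
  qed
  ultimately have "dim W = k" using Suc.prems by simp
  from Suc.IH[OF \<open>subspace W\<close> this] obtain x where
    "\<forall>j<k. x j \<in> W \<and> norm (x j) = 1"
    "\<forall>j<k. \<forall>l<k. j \<noteq> l \<longrightarrow> x j \<bullet> x l = 0 \<and> A (x j) \<bullet> A (x l) = 0"
    "\<forall>l<k. \<forall>j\<le>l. norm (A (x l)) \<le> norm (A (x j))"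
    "\<forall>y\<in>W. y = (\<Sum>j<k. (y \<bullet> x j) *\<^sub>R x j)"
    by (elim exE conjE)
  note x = this[rule_format]
  define x' where "x' = (\<lambda>j. case j of 0 \<Rightarrow> x0 | Suc j \<Rightarrow> x j)"
  have xV: "x j \<in> V" "x0 \<bullet> x j = 0" if "j < k" for j
    using x(1)[OF that] by (auto simp: Weq)
  have orth: "A x0 \<bullet> A (x j) = 0" if "j < k" for j
    using maximal_image_orthogonal[OF A Suc.prems(1) x0V(1) xV(1) max x0V(2) refl xV(2)] that by blast
  have norm_le: "norm (A (x j)) \<le> norm (A x0)" if "j < k" for j
    using max[of "x j"] xV x that by simp
  show ?case
  proof (intro exI[of _ x'] conjI allI impI ballI)
    fix j assume "j < Suc k"
    then show "x' j \<in> V" "norm (x' j) = 1"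
      using x0V xV x(1) by (auto simp: x'_def split: nat.split)
  next
    fix j l assume "j < Suc k" "l < Suc k" "j \<noteq> l"
    then show "x' j \<bullet> x' l = 0" "A (x' j) \<bullet> A (x' l) = 0"
      using xV(2) x(2) orth by (auto simp: x'_def inner_commute split: nat.split)
  next
    fix j l assume "l < Suc k" "j \<le> l"
    then show "norm (A (x' l)) \<le> norm (A (x' j))"
      using x(3) norm_le by (auto simp: x'_def split: nat.split)
  next
    fix y assume y: "y \<in> V"
    define z where "z = y - (y \<bullet> x0) *\<^sub>R x0"
    have "z \<in> W"
      using y x0V Suc.prems(1) by (simp add: z_def Weq subspace_diff subspace_scale inner_diff_right
          inner_commute norm_eq_1)
    have "z \<bullet> x j = y \<bullet> x j" if "j < k" for j
      using xV(2)[OF that] by (simp add: z_def inner_diff_left)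
    then have "z = (\<Sum>j<k. (y \<bullet> x j) *\<^sub>R x j)"
      using x(4)[OF \<open>z \<in> W\<close>] by simp
    then have "y = (y \<bullet> x0) *\<^sub>R x0 + (\<Sum>j<k. (y \<bullet> x j) *\<^sub>R x j)"
      by (simp add: z_def algebra_simps)
    then show "y = (\<Sum>j<Suc k. (y \<bullet> x' j) *\<^sub>R x' j)"
      by (simp add: sum.lessThan_Suc_shift x'_def del: sum.lessThan_Suc)
  qed
qed

text \<open>The radii demand subspaces of an exact dimension, while image axes may vanish and span
  too little. The missing dimensions are filled by adjoining outside vectors one at a time; with
  empty \<open>W\<close> this yields some subspace of each dimension.\<close>

lemma subspace_of_dim_containing:
  fixes W :: "'a::euclidean_space set"
  assumes "dim W \<le> m" "m \<le> DIM('a)"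
  obtains L where "subspace L" "dim L = m" "W \<subseteq> L"
proof -
  have "\<exists>L. subspace L \<and> dim L = dim W + d \<and> W \<subseteq> L" if "dim W + d \<le> DIM('a)" for d
    using that
  proof (induction d)
    case 0
    then show ?case by (intro exI[of _ "span W"]) (auto simp: span_superset)
  next
    case (Suc d)
    then obtain L where L: "subspace L" "dim L = dim W + d" "W \<subseteq> L" by auto
    then have "L \<noteq> UNIV" using Suc.prems by auto
    then obtain v where "v \<notin> L" by auto
    then have "v \<notin> span L" using L(1) by (metis span_eq_iff)
    then show ?case
      using L by (intro exI[of _ "span (insert v L)"]) (auto simp: dim_insert intro: span_base)
  qed
  from this[of "m - dim W"] show thesis using assms that by auto
qed

text \<open>The \<open>i\<close>-th image axis belongs both to the \<open>i\<close> longest ones,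
  none shorter than \<sigma>, and to those from the \<open>i\<close>-th on, none longer than
  \<sigma>. This is why one \<sigma> serves the section by \<open>L\<close> and the projection along
  \<open>M\<close>.\<close>

lemma ellipsoid_section_projection:
  fixes A :: "'a::euclidean_space \<Rightarrow> 'a"
  assumes A: "linear A" and i: "1 \<le> i" "i \<le> DIM('a)"
  obtains \<sigma> L M where "\<sigma> \<ge> 0" "subspace L" "dim L = i" "subspace M" "dim M = i - 1"
    "\<And>y. y \<in> L \<Longrightarrow> norm y \<le> 1 \<Longrightarrow> \<exists>x. norm x \<le> 1 \<and> \<sigma> *\<^sub>R y = A x"
    "\<And>x. norm x \<le> 1 \<Longrightarrow> \<exists>y z. norm y \<le> 1 \<and> z \<in> M \<and> A x = \<sigma> *\<^sub>R y + z"
proof -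
  let ?n = "DIM('a)"
  obtain x where
    "\<forall>j<?n. x j \<in> UNIV \<and> norm (x j) = 1"
    "\<forall>j<?n. \<forall>l<?n. j \<noteq> l \<longrightarrow> x j \<bullet> x l = 0 \<and> A (x j) \<bullet> A (x l) = 0"
    "\<forall>l<?n. \<forall>j\<le>l. norm (A (x l)) \<le> norm (A (x j))"
    "\<forall>y\<in>UNIV. y = (\<Sum>j<?n. (y \<bullet> x j) *\<^sub>R x j)"
    using singular_value_basis[OF A subspace_UNIV dim_UNIV] by (elim exE conjE)
  note x = this[rule_format] and expand = this(4)[rule_format, OF UNIV_I]
  have norm_sum: "(norm (\<Sum>j\<in>J. c j *\<^sub>R x j))\<^sup>2 = (\<Sum>j\<in>J. (c j)\<^sup>2)"
    "(norm (\<Sum>j\<in>J. c j *\<^sub>R A (x j)))\<^sup>2 = (\<Sum>j\<in>J. (c j)\<^sup>2 * (norm (A (x j)))\<^sup>2)"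
    if "J \<subseteq> {..<?n}" for J c
  proof -
    have fin: "finite J" using that finite_subset by blast
    have "(norm (\<Sum>j\<in>J. c j *\<^sub>R x j))\<^sup>2 = (\<Sum>j\<in>J. (norm (c j *\<^sub>R x j))\<^sup>2)"
      using x(2) that by (intro norm_sum_Pythagorean fin) (auto simp: pairwise_def orthogonal_def subset_iff)
    also have "\<dots> = (\<Sum>j\<in>J. (c j)\<^sup>2)"
      using x(1) that by (intro sum.cong) (auto simp: power_mult_distrib)
    finally show "(norm (\<Sum>j\<in>J. c j *\<^sub>R x j))\<^sup>2 = (\<Sum>j\<in>J. (c j)\<^sup>2)" .
    have "(norm (\<Sum>j\<in>J. c j *\<^sub>R A (x j)))\<^sup>2 = (\<Sum>j\<in>J. (norm (c j *\<^sub>R A (x j)))\<^sup>2)"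
      using x(2) that by (intro norm_sum_Pythagorean fin) (auto simp: pairwise_def orthogonal_def subset_iff)
    also have "\<dots> = (\<Sum>j\<in>J. (c j)\<^sup>2 * (norm (A (x j)))\<^sup>2)"
      by (simp add: power_mult_distrib)
    finally show "(norm (\<Sum>j\<in>J. c j *\<^sub>R A (x j)))\<^sup>2 = (\<Sum>j\<in>J. (c j)\<^sup>2 * (norm (A (x j)))\<^sup>2)" .
  qed
  define \<sigma> where "\<sigma> = norm (A (x (i - 1)))"
  have "\<sigma> \<ge> 0" by (simp add: \<sigma>_def)
  \<comment> \<open>Indices start at 0, so index \<open>i - 1\<close> in \<sigma> is the
    \<open>i\<close>-th largest singular value, and the indices below \<open>i - 1\<close> give the
    vectors spanning into \<open>M\<close>.\<close>
  define u where "u = (\<lambda>j. A (x j))"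
  have "dim (span (u ` {..<i - 1})) \<le> i - 1"
    by (metis card_image_le card_lessThan dim_le_card dim_span finite_imageI finite_lessThan
        le_trans order_refl span_superset)
  then obtain M where M: "subspace M" "dim M = i - 1" "span (u ` {..<i - 1}) \<subseteq> M"
    using subspace_of_dim_containing i by (metis diff_le_self le_trans)
  have M_ok: "\<exists>y z. norm y \<le> 1 \<and> z \<in> M \<and> A v = \<sigma> *\<^sub>R y + z" if v: "norm v \<le> 1" for v
  proof -
    define z where "z = (\<Sum>j<i - 1. (v \<bullet> x j) *\<^sub>R u j)"
    define w where "w = (\<Sum>j\<in>{i - 1..<?n}. (v \<bullet> x j) *\<^sub>R u j)"
    have "A v = (\<Sum>j<?n. (v \<bullet> x j) *\<^sub>R u j)"
      by (subst expand[of v]) (simp add: u_def linear_sum[OF A] linear_scale[OF A])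
    also have "{..<?n} = {..<i - 1} \<union> {i - 1..<?n}" using i by auto
    also have "(\<Sum>j\<in>\<dots>. (v \<bullet> x j) *\<^sub>R u j) = z + w"
      unfolding z_def w_def by (intro sum.union_disjoint) auto
    finally have Av: "A v = z + w" .
    have "z \<in> M"
      using M(3) unfolding z_def
      by (intro subspace_sum subspace_scale M(1)) (auto intro!: span_base)
    have "(norm w)\<^sup>2 = (\<Sum>j\<in>{i - 1..<?n}. (v \<bullet> x j)\<^sup>2 * (norm (A (x j)))\<^sup>2)"
      unfolding w_def u_def by (rule norm_sum) auto
    also have "\<dots> \<le> (\<Sum>j\<in>{i - 1..<?n}. (v \<bullet> x j)\<^sup>2 * \<sigma>\<^sup>2)"
      unfolding \<sigma>_def by (intro sum_mono mult_left_mono power_mono x(3)) auto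
    also have "\<dots> \<le> (\<Sum>j<?n. (v \<bullet> x j)\<^sup>2 * \<sigma>\<^sup>2)"
      by (intro sum_mono2) auto
    also have "\<dots> = (norm v)\<^sup>2 * \<sigma>\<^sup>2"
      using norm_sum(1)[of "{..<?n}" "\<lambda>j. v \<bullet> x j"] expand[of v] by (simp add: sum_distrib_right)
    also have "\<dots> = (norm v * \<sigma>)\<^sup>2" by (simp add: power_mult_distrib)
    finally have "norm w \<le> norm v * \<sigma>"
      using \<open>\<sigma> \<ge> 0\<close> by (meson mult_nonneg_nonneg norm_ge_zero power2_le_imp_le)
    also have "\<dots> \<le> \<sigma>" using v \<open>\<sigma> \<ge> 0\<close> by (simp add: mult_left_le_one_le)
    finally have w: "norm w \<le> \<sigma>" .
    show ?thesis
    proof (cases "\<sigma> = 0")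
      case True
      then show ?thesis using w Av \<open>z \<in> M\<close> by (intro exI[of _ 0] exI[of _ z]) auto
    next
      case False
      then show ?thesis using w Av \<open>z \<in> M\<close> \<open>\<sigma> \<ge> 0\<close>
        by (intro exI[of _ "w /\<^sub>R \<sigma>"] exI[of _ z]) (auto simp: field_simps)
    qed
  qed
  show thesis
  proof (cases "\<sigma> = 0")
    case True
    \<comment> \<open>The first \<open>i\<close> image axes do not span \<open>i\<close> dimensions
      here, but any \<open>L\<close> of that dimension serves, since
      \<open>\<sigma> y = 0 = A 0\<close>.\<close>
    obtain L :: "'a set" where L: "subspace L" "dim L = i"
      using subspace_of_dim_containing[of "{}::'a set" i] i by auto
    show thesis
    proof (rule that[OF \<open>\<sigma> \<ge> 0\<close> L M(1,2) _ M_ok])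
      fix y :: 'a
      show "\<exists>x. norm x \<le> 1 \<and> \<sigma> *\<^sub>R y = A x"
        using True linear_0[OF A] by (intro exI[of _ 0]) auto
    qed
  next
    case False
    then have \<sigma>: "\<sigma> > 0" using \<open>\<sigma> \<ge> 0\<close> by simp
    have ge: "norm (u j) \<ge> \<sigma>" if "j < i" for j
      unfolding u_def \<sigma>_def using that i by (intro x(3)) auto
    define L where "L = span (u ` {..<i})"
    have un0: "u j \<noteq> 0" if "j < i" for j using ge[OF that] \<sigma> by auto
    have uo: "u j \<bullet> u l = 0" if "j < i" "l < i" "j \<noteq> l" for j l
      using x(2)[of j l] that i by (auto simp: u_def)
    have "inj_on u {..<i}"
    proof (rule inj_onI)
      fix j l assume jl: "j \<in> {..<i}" "l \<in> {..<i}" "u j = u l"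
      then show "j = l" using uo[of j l] un0[of j] by auto
    qed
    moreover have "independent (u ` {..<i})"
    proof (rule pairwise_orthogonal_independent)
      show "pairwise orthogonal (u ` {..<i})"
        using uo by (auto simp: pairwise_def orthogonal_def)
    qed (use un0 in auto)
    ultimately have "dim L = i"
      by (simp add: L_def dim_eq_card_independent card_image)
    show thesis
    proof (rule that[OF \<open>\<sigma> \<ge> 0\<close> _ \<open>dim L = i\<close> M(1,2) _ M_ok])
      show "subspace L" by (simp add: L_def)
      fix y assume y: "y \<in> L" "norm y \<le> 1"
      have "\<exists>c. y = (\<Sum>j<i. c j *\<^sub>R u j)"
      proof -
        from y(1) obtain d where "y = (\<Sum>v\<in>u ` {..<i}. d v *\<^sub>R v)"
          unfolding L_def by (subst (asm) span_finite) auto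
        then have "y = (\<Sum>j<i. d (u j) *\<^sub>R u j)"
          using sum.reindex[OF \<open>inj_on u {..<i}\<close>, of "\<lambda>v. d v *\<^sub>R v"] by simp
        then show ?thesis by (intro exI[of _ "\<lambda>j. d (u j)"])
      qed
      then obtain c where c: "y = (\<Sum>j<i. c j *\<^sub>R u j)" by blast
      \<comment> \<open>An explicit preimage of \<open>\<sigma> y\<close>. Its norm is at most that
        of \<open>y\<close> because none of the first \<open>i\<close> image axes is shorter than
        \<sigma>.\<close>
      define v where "v = (\<Sum>j<i. (\<sigma> * c j) *\<^sub>R x j)"
      have "A v = (\<Sum>j<i. (\<sigma> * c j) *\<^sub>R u j)"
        by (simp add: v_def u_def linear_sum[OF A] linear_scale[OF A])
      also have "\<dots> = \<sigma> *\<^sub>R y" by (simp add: c scaleR_sum_right)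
      finally have Av: "\<sigma> *\<^sub>R y = A v" by simp
      have "(norm v)\<^sup>2 = (\<Sum>j<i. (\<sigma> * c j)\<^sup>2)"
        unfolding v_def using i by (intro norm_sum) auto
      also have "\<dots> \<le> (\<Sum>j<i. (c j)\<^sup>2 * (norm (A (x j)))\<^sup>2)"
      proof (rule sum_mono)
        fix j assume "j \<in> {..<i}"
        then have "(c j)\<^sup>2 * \<sigma>\<^sup>2 \<le> (c j)\<^sup>2 * (norm (A (x j)))\<^sup>2"
          using ge[of j] \<sigma> by (intro mult_left_mono power_mono) (auto simp: u_def)
        then show "(\<sigma> * c j)\<^sup>2 \<le> (c j)\<^sup>2 * (norm (A (x j)))\<^sup>2"
          by (simp add: power_mult_distrib mult.commute)
      qed
      also have "\<dots> = (norm y)\<^sup>2"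
        unfolding c u_def using i by (intro norm_sum(2)[symmetric]) auto
      finally have "norm v \<le> norm y" by (rule power2_le_imp_le) simp
      then show "\<exists>x. norm x \<le> 1 \<and> \<sigma> *\<^sub>R y = A x"
        using Av y(2) by (intro exI[of _ v]) auto
    qed
  qed
qed

section \<open>Radii\<close>

text \<open>Expanding in the basis gives \<open>C\<close>, which makes \<open>N\<close> Lipschitz;
  \<open>N\<close> then attains its minimum \<open>m\<close> on the Euclidean unit sphere.\<close>

lemma is_norm_bounds:
  fixes N :: "'a::euclidean_space \<Rightarrow> real"
  assumes N: "is_norm N"
  obtains m C where "m > 0" "\<And>x. m * norm x \<le> N x" "\<And>x. N x \<le> C * norm x" "continuous_on UNIV N"
proof -
  have N0: "N x = 0 \<longleftrightarrow> x = 0" and Nscale: "N (c *\<^sub>R x) = \<bar>c\<bar> * N x"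
    and Ntri: "N (x + y) \<le> N x + N y" for x y c
    using N by (auto simp: is_norm_def)
  have Nneg: "N (- x) = N x" for x using Nscale[of "-1" x] by simp
  have Npos: "N x \<ge> 0" for x using Ntri[of x "- x"] N0[of 0] Nneg[of x] by simp
  define C where "C = (\<Sum>b\<in>Basis. N (b::'a))"
  have Nsum: "N (\<Sum>b\<in>S. f b) \<le> (\<Sum>b\<in>S. N (f b))" if "finite S" for S and f :: "'a \<Rightarrow> 'a"
    using that
  proof (induction S)
    case empty
    then show ?case using N0[of 0] by simp
  next
    case (insert b S)
    then show ?case using Ntri[of "f b" "sum f S"] by simp
  qed
  have upper: "N x \<le> C * norm x" for x
  proof -
    have "N x = N (\<Sum>b\<in>Basis. (x \<bullet> b) *\<^sub>R b)" by (simp add: euclidean_representation)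
    also have "\<dots> \<le> (\<Sum>b\<in>Basis. \<bar>x \<bullet> b\<bar> * N b)"
      using Nsum[of Basis "\<lambda>b. (x \<bullet> b) *\<^sub>R b"] by (simp add: Nscale)
    also have "\<dots> \<le> (\<Sum>b\<in>Basis. norm x * N b)"
      by (intro sum_mono mult_right_mono Basis_le_norm Npos)
    finally show ?thesis by (simp add: C_def sum_distrib_left mult.commute)
  qed
  have "\<bar>N x - N y\<bar> \<le> C * norm (x - y)" for x y
    using Ntri[of "x - y" y] Ntri[of "y - x" x] upper[of "x - y"] Nneg[of "x - y"] by simp
  then have "C-lipschitz_on UNIV N"
    using Npos by (intro lipschitz_onI) (auto simp: dist_norm C_def sum_nonneg)
  then have cont: "continuous_on UNIV N" by (rule lipschitz_on_continuous_on)
  have "\<exists>x\<in>sphere (0::'a) 1. \<forall>y\<in>sphere 0 1. N x \<le> N y"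
    using cont by (intro continuous_attains_inf) (auto intro: continuous_on_subset)
  then obtain e where e: "norm e = 1" "\<And>y. norm y = 1 \<Longrightarrow> N e \<le> N y" by auto
  have "N e > 0" using Npos[of e] N0[of e] e(1) by fastforce
  moreover have "N e * norm x \<le> N x" for x
  proof (cases "x = 0")
    case False
    then have "N e \<le> N (x /\<^sub>R norm x)" by (intro e(2)) simp
    also have "\<dots> = N x / norm x" by (simp add: Nscale divide_inverse mult.commute)
    finally show ?thesis using False by (simp add: field_simps)
  qed (use N0[of 0] in simp)
  ultimately show thesis using that upper cont by blast
qed

lemma norm_ball_properties:
  fixes N :: "'a::euclidean_space \<Rightarrow> real"
  assumes N: "is_norm N"
  shows "compact {x. N x \<le> 1}" "convex {x. N x \<le> 1}" "0 \<in> {x. N x \<le> 1}" "\<forall>x\<in>{x. N x \<le> 1}. - x \<in> {x. N x \<le> 1}"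
proof -
  obtain m C where mC: "m > 0" "\<And>x. m * norm x \<le> N x" "\<And>x. N x \<le> C * norm x" "continuous_on UNIV N"
    by (rule is_norm_bounds[OF N]) blast
  have "closed {x. N x \<le> 1}"
    using mC(4) by (intro closed_Collect_le continuous_on_const) auto
  moreover have "norm x \<le> 1 / m" if "N x \<le> 1" for x
    using mC(1) mC(2)[of x] that by (simp add: field_simps)
  then have "bounded {x. N x \<le> 1}" by (auto simp: bounded_iff)
  ultimately show "compact {x. N x \<le> 1}" by (simp add: compact_eq_bounded_closed)
  show "convex {x. N x \<le> 1}"
  proof (rule convexI)
    fix x y and u v :: real
    assume *: "x \<in> {x. N x \<le> 1}" "y \<in> {x. N x \<le> 1}" "0 \<le> u" "0 \<le> v" "u + v = 1"
    have "N (u *\<^sub>R x + v *\<^sub>R y) \<le> N (u *\<^sub>R x) + N (v *\<^sub>R y)" using N unfolding is_norm_def by blast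
    also have "\<dots> = u * N x + v * N y" using N * by (simp add: is_norm_def)
    also have "\<dots> \<le> u * 1 + v * 1" using * by (intro add_mono mult_left_mono) auto
    finally show "u *\<^sub>R x + v *\<^sub>R y \<in> {x. N x \<le> 1}" using * by simp
  qed
  have "N 0 = 0" using N unfolding is_norm_def by blast
  then show "0 \<in> {x. N x \<le> 1}" by simp
  have "N (- x) = N x" for x
  proof -
    have "N ((-1) *\<^sub>R x) = \<bar>-1\<bar> * N x" using N unfolding is_norm_def by blast
    then show ?thesis by simp
  qed
  then show "\<forall>x\<in>{x. N x \<le> 1}. - x \<in> {x. N x \<le> 1}" by simp
qed

section \<open>From sections and projections to the two radii\<close>

lemma circumradius_i_le:
  assumes "0 \<le> \<rho>" "L \<in> lin_subspaces (DIM('a) - i)"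
    "K \<subseteq> {x + \<rho> *\<^sub>R c + l | c l. c \<in> C \<and> l \<in> L}"
  shows "circumradius_i i (K :: 'a::euclidean_space set) C \<le> \<rho>"
  unfolding circumradius_i_def using assms by (intro cInf_lower bdd_belowI[of _ 0]) auto

text \<open>The real supremum bounds its members only if they are bounded above. As
  \<open>i \<ge> 1\<close>, every \<open>L\<close> contains some \<open>w\<close> with
  \<open>N w = 1\<close>; both \<open>x\<close> and \<open>x + \<rho> w\<close> lie in
  \<open>K\<close>, so \<open>\<rho> * norm w \<le> 2 * R\<close>, while
  \<open>1 \<le> C * norm w\<close>.\<close>

lemma inradius_i_ge:
  fixes K :: "'a::euclidean_space set"
  assumes N: "is_norm N" and K: "bounded K" and i: "1 \<le> i"
    and "0 \<le> \<rho>" "L \<in> lin_subspaces i" "(\<lambda>c. x + \<rho> *\<^sub>R c) ` ({x. N x \<le> 1} \<inter> L) \<subseteq> K"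
  shows "\<rho> \<le> inradius_i i K {x. N x \<le> 1}"
  unfolding inradius_i_def
proof (rule cSup_upper)
  show "\<rho> \<in> {\<rho>. 0 \<le> \<rho> \<and> (\<exists>L\<in>lin_subspaces i. \<exists>x. (\<lambda>c. x + \<rho> *\<^sub>R c) ` ({x. N x \<le> 1} \<inter> L) \<subseteq> K)}"
    using assms by blast
  obtain m C where mC: "m > 0" "\<And>x. m * norm x \<le> N x" "\<And>x. N x \<le> C * norm x" "continuous_on UNIV N"
    by (rule is_norm_bounds[OF N]) blast
  obtain R where R: "\<And>x. x \<in> K \<Longrightarrow> norm x \<le> R"
    using K by (auto simp: bounded_iff)
  show "bdd_above {\<rho>. 0 \<le> \<rho> \<and> (\<exists>L\<in>lin_subspaces i. \<exists>x. (\<lambda>c. x + \<rho> *\<^sub>R c) ` ({x. N x \<le> 1} \<inter> L) \<subseteq> K)}"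
  proof (rule bdd_aboveI[of _ "2 * R * C"], clarify)
    fix \<rho> :: real and L :: "'a set" and x
    assume *: "0 \<le> \<rho>" "L \<in> lin_subspaces i" "(\<lambda>c. x + \<rho> *\<^sub>R c) ` ({x. N x \<le> 1} \<inter> L) \<subseteq> K"
    then have L: "subspace L" "dim L = i" by (auto simp: lin_subspaces_def)
    then have "L \<noteq> {0}" using i by auto
    then obtain v where v: "v \<in> L" "v \<noteq> 0" using subspace_0[OF L(1)] by auto
    have Nv: "N v > 0" using mC(1) mC(2)[of v] v by (smt (verit) mult_pos_pos zero_less_norm_iff)
    define w where "w = v /\<^sub>R N v"
    have w: "w \<in> L" "N w = 1"
      using v L Nv N by (auto simp: w_def subspace_scale is_norm_def)
    have "w \<in> {x. N x \<le> 1} \<inter> L" using w by simp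
    then have "x + \<rho> *\<^sub>R w \<in> K" using * by blast
    moreover have "x + \<rho> *\<^sub>R 0 \<in> K"
      using * subspace_0[OF L(1)] norm_ball_properties(3)[OF N] by blast
    ultimately have "norm (x + \<rho> *\<^sub>R w) \<le> R" "norm x \<le> R" using R by auto
    then have "norm ((x + \<rho> *\<^sub>R w) - x) \<le> R + R" by (intro norm_triangle_le_diff) auto
    then have 1: "\<rho> * norm w \<le> 2 * R" using * by simp
    have "C > 0" using mC(3)[of w] w by (smt (verit) mult_nonpos_nonneg norm_ge_zero)
    have "\<rho> \<le> \<rho> * (C * norm w)" using mC(3)[of w] w * by (simp add: mult_left_le mult_le_cancel_left1)
    also have "\<dots> = (\<rho> * norm w) * C" by simp
    also have "\<dots> \<le> 2 * R * C" using 1 \<open>C > 0\<close> by (intro mult_right_mono) auto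
    finally show "\<rho> \<le> 2 * R * C" .
  qed
qed

text \<open>In the coordinates given by \<open>S\<close> the norm ball lies between the Euclidean
  balls of radii 1 and \<mu>, and \<open>T\<close> becomes \<open>A\<close>. The projection of
  \<open>K\<close> costs the factor \<kappa>, the section of the norm ball the factor \<mu>.\<close>

lemma circumradius_le_inradius:
  fixes N :: "'a::euclidean_space \<Rightarrow> real" and T S :: "'a \<Rightarrow> 'a"
  assumes N: "is_norm N" and K: "bounded K" and i: "1 \<le> i" "i \<le> DIM('a)"
    and T: "linear T" "\<And>x. norm x \<le> 1 \<Longrightarrow> c + T x \<in> K"
      "\<And>y. y \<in> K \<Longrightarrow> \<exists>q. norm q \<le> \<kappa> \<and> y = c + T q"
    and S: "linear S" "\<And>x. norm x \<le> 1 \<Longrightarrow> N (S x) \<le> 1"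
      "\<And>y. N y \<le> 1 \<Longrightarrow> \<exists>q. norm q \<le> \<mu> \<and> y = S q"
    and pos: "\<kappa> > 0" "\<mu> > 0"
  shows "circumradius_i (DIM('a) - i + 1) K {x. N x \<le> 1} \<le> \<kappa> * \<mu> * inradius_i i K {x. N x \<le> 1}"
proof -
  obtain m C where mC: "m > 0" "\<And>x. m * norm x \<le> N x" "\<And>x. N x \<le> C * norm x" "continuous_on UNIV N"
    by (rule is_norm_bounds[OF N]) blast
  \<comment> \<open>Scaling a nonzero \<open>y\<close> to \<open>N\<close>-norm 1 puts it into the
    norm ball, which the range of \<open>S\<close> covers.\<close>
  have "surj S"
    unfolding surj_def
  proof
    fix y :: 'a
    show "\<exists>x. y = S x"
    proof (cases "y = 0")
      case True
      then show ?thesis using linear_0[OF S(1)] by metis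
    next
      case False
      then have Ny: "N y > 0" using mC(1) mC(2)[of y] by (smt (verit) mult_pos_pos zero_less_norm_iff)
      have "N (y /\<^sub>R N y) = \<bar>inverse (N y)\<bar> * N y" using N unfolding is_norm_def by blast
      then have "N (y /\<^sub>R N y) \<le> 1" using Ny by simp
      then obtain q where "y /\<^sub>R N y = S q" using S(3) by blast
      then have "y = S (N y *\<^sub>R q)"
        using Ny by (simp add: linear_scale[OF S(1)] flip: \<open>y /\<^sub>R N y = S q\<close>)
      then show ?thesis by blast
    qed
  qed
  then have "inj S" using linear_surjective_imp_injective[OF S(1)] by simp
  obtain S' where S': "linear S'" "\<And>x. S (S' x) = x"
    using linear_surjective_isomorphism[OF S(1) \<open>surj S\<close>] by blast
  define A where "A = S' \<circ> T"
  have "linear A" unfolding A_def using T(1) S'(1) by (rule linear_compose)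
  have SA: "S (A x) = T x" for x by (simp add: A_def S')
  obtain \<sigma> L M where \<sigma>: "\<sigma> \<ge> 0" and L: "subspace L" "dim L = i" and M: "subspace M" "dim M = i - 1"
    and LA: "\<And>y. y \<in> L \<Longrightarrow> norm y \<le> 1 \<Longrightarrow> \<exists>x. norm x \<le> 1 \<and> \<sigma> *\<^sub>R y = A x"
    and AM: "\<And>x. norm x \<le> 1 \<Longrightarrow> \<exists>y z. norm y \<le> 1 \<and> z \<in> M \<and> A x = \<sigma> *\<^sub>R y + z"
    by (rule ellipsoid_section_projection[OF \<open>linear A\<close> i]) blast
  have dimS: "dim (S ` X) = dim X" for X
    using dim_image_eq[OF S(1)] \<open>inj S\<close> inj_on_subset by blast
  have "circumradius_i (DIM('a) - i + 1) K {x. N x \<le> 1} \<le> \<kappa> * \<sigma>"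
  proof (rule circumradius_i_le)
    show "0 \<le> \<kappa> * \<sigma>" using pos \<sigma> by simp
    \<comment> \<open>The circumradius of index \<open>n - i + 1\<close> allows a subspace of
      dimension \<open>i - 1\<close>, exactly that of \<open>M\<close>.\<close>
    have "DIM('a) - (DIM('a) - i + 1) = i - 1" using i by simp
    then show "S ` M \<in> lin_subspaces (DIM('a) - (DIM('a) - i + 1))"
      using M S(1) by (simp add: lin_subspaces_def dimS linear_subspace_image)
    show "K \<subseteq> {c + (\<kappa> * \<sigma>) *\<^sub>R b + l |b l. b \<in> {x. N x \<le> 1} \<and> l \<in> S ` M}"
    proof
      fix y assume "y \<in> K"
      then obtain q where q: "norm q \<le> \<kappa>" "y = c + T q" using T(3) by blast
      then have "norm (q /\<^sub>R \<kappa>) \<le> 1" using pos by (simp add: field_simps)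
      then obtain b z where bz: "norm b \<le> 1" "z \<in> M" "A (q /\<^sub>R \<kappa>) = \<sigma> *\<^sub>R b + z" using AM by blast
      have "T q = T (\<kappa> *\<^sub>R (q /\<^sub>R \<kappa>))" using pos by simp
      also have "\<dots> = \<kappa> *\<^sub>R S (\<sigma> *\<^sub>R b + z)"
        by (subst linear_scale[OF T(1)]) (simp only: bz(3)[symmetric] SA)
      also have "\<dots> = (\<kappa> * \<sigma>) *\<^sub>R S b + S (\<kappa> *\<^sub>R z)"
        by (simp add: linear_add[OF S(1)] linear_scale[OF S(1)] scaleR_add_right)
      finally have "y = c + (\<kappa> * \<sigma>) *\<^sub>R S b + S (\<kappa> *\<^sub>R z)" using q(2) by simp
      moreover have "S b \<in> {x. N x \<le> 1}" using S(2) bz(1) by simp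
      moreover have "S (\<kappa> *\<^sub>R z) \<in> S ` M" using M(1) bz(2) by (simp add: subspace_scale)
      ultimately show "y \<in> {c + (\<kappa> * \<sigma>) *\<^sub>R b + l |b l. b \<in> {x. N x \<le> 1} \<and> l \<in> S ` M}" by blast
    qed
  qed
  also have "\<sigma> / \<mu> \<le> inradius_i i K {x. N x \<le> 1}"
  proof (rule inradius_i_ge[OF N K i(1)])
    show "0 \<le> \<sigma> / \<mu>" using \<sigma> pos by simp
    show "S ` L \<in> lin_subspaces i"
      using L S(1) by (simp add: lin_subspaces_def dimS linear_subspace_image)
    \<comment> \<open>\<open>N (S l) \<le> 1\<close> yields only \<open>norm l \<le> \<mu>\<close>,
      so \<open>l\<close> is divided by \<mu> before the section property of \<open>L\<close>
      applies.\<close>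
    show "(\<lambda>b. c + (\<sigma> / \<mu>) *\<^sub>R b) ` ({x. N x \<le> 1} \<inter> S ` L) \<subseteq> K"
    proof clarify
      fix l assume l: "N (S l) \<le> 1" "l \<in> L"
      then obtain q where "norm q \<le> \<mu>" "S l = S q" using S(3) by blast
      then have "norm l \<le> \<mu>" using \<open>inj S\<close> by (metis injD)
      then have "norm (l /\<^sub>R \<mu>) \<le> 1" "l /\<^sub>R \<mu> \<in> L" using pos L(1) l(2)
        by (simp_all add: subspace_scale field_simps)
      then obtain x where x: "norm x \<le> 1" "\<sigma> *\<^sub>R (l /\<^sub>R \<mu>) = A x" using LA by blast
      have "(\<sigma> / \<mu>) *\<^sub>R S l = S (\<sigma> *\<^sub>R (l /\<^sub>R \<mu>))"
        by (simp add: linear_scale[OF S(1)] divide_inverse)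
      also have "\<dots> = T x" by (simp only: x(2) SA)
      finally show "c + (\<sigma> / \<mu>) *\<^sub>R S l \<in> K" using T(2)[OF x(1)] by simp
    qed
  qed
  then have "\<kappa> * \<sigma> \<le> \<kappa> * \<mu> * inradius_i i K {x. N x \<le> 1}"
    using pos by (simp add: field_simps)
  finally show ?thesis .
qed

text \<open>\<kappa> records what is known of \<open>K\<close> and \<mu> what is known of the norm,
  independently. All bounds are instances: n times sqrt n in general, n times 1 for a Euclidean
  ball, sqrt n times sqrt n for symmetric \<open>K\<close>, and sqrt n times 1 for both.\<close>

lemma circumradius_inradius_ratio:
  fixes N :: "'a::euclidean_space \<Rightarrow> real"
  assumes N: "is_norm N" and K: "convex_body K" and i: "1 \<le> i" "i \<le> DIM('a)"
    and r: "inradius_i i K {x. N x \<le> 1} > 0"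
    and \<kappa>: "\<kappa> = real DIM('a) \<or> \<kappa> = sqrt (real DIM('a)) \<and> (\<forall>x\<in>K. - x \<in> K)"
    and \<mu>: "\<mu> = sqrt (real DIM('a)) \<or> \<mu> = 1 \<and> (\<forall>x. N x = norm x)"
  shows "circumradius_i (DIM('a) - i + 1) K {x. N x \<le> 1} / inradius_i i K {x. N x \<le> 1} \<le> \<kappa> * \<mu>"
proof -
  have pos: "\<kappa> > 0" "\<mu> > 0" using \<kappa> \<mu> by auto
  have "circumradius_i (DIM('a) - i + 1) K {x. N x \<le> 1} \<le> \<kappa> * \<mu> * inradius_i i K {x. N x \<le> 1}"
  proof (cases "K = {}")
    \<comment> \<open>The inradius is then \<open>Sup {}\<close>, an unspecified real number.\<close>
    case True
    obtain L :: "'a set" where "subspace L" "dim L = DIM('a) - (DIM('a) - i + 1)"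
      using subspace_of_dim_containing[of "{}::'a set" "DIM('a) - (DIM('a) - i + 1)"] by auto
    then have "circumradius_i (DIM('a) - i + 1) K {x. N x \<le> 1} \<le> 0"
      using True by (intro circumradius_i_le[of 0 L]) (auto simp: lin_subspaces_def)
    also have "0 \<le> \<kappa> * \<mu> * inradius_i i K {x. N x \<le> 1}" using pos r by simp
    finally show ?thesis .
  next
    case False
    have Kc: "compact K" "convex K" using K by (auto simp: convex_body_def)
    obtain T :: "'a \<Rightarrow> 'a" and c where T: "linear T" "\<And>x. norm x \<le> 1 \<Longrightarrow> c + T x \<in> K"
      "\<And>y. y \<in> K \<Longrightarrow> \<exists>q. norm q \<le> \<kappa> \<and> y = c + T q"
      by (rule john[OF Kc False \<kappa>]) blast
    have "\<exists>S :: 'a \<Rightarrow> 'a. linear S \<and> (\<forall>x. norm x \<le> 1 \<longrightarrow> N (S x) \<le> 1) \<and>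
      (\<forall>y. N y \<le> 1 \<longrightarrow> (\<exists>q. norm q \<le> \<mu> \<and> y = S q))"
      using \<mu>
    proof
      assume "\<mu> = 1 \<and> (\<forall>x. N x = norm x)"
      then show ?thesis by (intro exI[of _ id]) (auto simp: linear_id)
    next
      assume \<mu>: "\<mu> = sqrt (real DIM('a))"
      note B = norm_ball_properties[OF N]
      have "\<mu> = real DIM('a) \<or> \<mu> = sqrt (real DIM('a)) \<and> (\<forall>x\<in>{x. N x \<le> 1}. - x \<in> {x. N x \<le> 1})"
        using \<mu> B(4) by blast
      note sym = this
      have ne: "{x. N x \<le> 1} \<noteq> {}" using B(3) by blast
      obtain S :: "'a \<Rightarrow> 'a" and d where S: "linear S" "\<And>x. norm x \<le> 1 \<Longrightarrow> d + S x \<in> {x. N x \<le> 1}"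
        "\<And>y. y \<in> {x. N x \<le> 1} \<Longrightarrow> \<exists>q. norm q \<le> \<mu> \<and> y = d + S q"
        by (rule john[OF B(1,2) ne sym]) blast
      \<comment> \<open>By symmetry the centre \<open>d\<close> can be moved to the origin.\<close>
      have "S x \<in> {x. N x \<le> 1}" if "norm x \<le> 1" for x
      proof -
        have "- (d + S (- x)) \<in> {x. N x \<le> 1}" using that by (intro B(4)[rule_format] S(2)) simp
        then have "(1/2) *\<^sub>R (d + S x) + (1/2) *\<^sub>R (- (d + S (- x))) \<in> {x. N x \<le> 1}"
          using that S(2)[of x] by (intro convexD[OF B(2)]) auto
        then show ?thesis
          by (simp add: linear_neg[OF S(1)] flip: scaleR_add_right scaleR_add_left)
      qed
      moreover have "\<exists>q. norm q \<le> \<mu> \<and> y = S q" if Ny: "N y \<le> 1" for y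
      proof -
        have y: "y \<in> {x. N x \<le> 1}" using Ny by simp
        obtain q where q: "norm q \<le> \<mu>" "y = d + S q" using S(3)[OF y] by blast
        obtain q' where q': "norm q' \<le> \<mu>" "- y = d + S q'" 
          using S(3)[OF B(4)[rule_format, OF y]] by blast
        have "y - - y = S (q - q')" unfolding q'(2) by (simp add: q(2) linear_diff[OF S(1)])
        then have "y = S ((1/2) *\<^sub>R (q - q'))"
          by (simp add: linear_scale[OF S(1)] flip: \<open>y - - y = S (q - q')\<close> scaleR_2)
        moreover have "norm (q - q') \<le> \<mu> + \<mu>"
          using q(1) q'(1) by (intro norm_triangle_le_diff) auto
        then have "norm ((1/2) *\<^sub>R (q - q')) \<le> \<mu>" by simp
        ultimately show ?thesis by blast
      qed
      ultimately show ?thesis using S(1) by (intro exI[of _ S]) auto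
    qed
    then obtain S :: "'a \<Rightarrow> 'a" where "linear S" "\<forall>x. norm x \<le> 1 \<longrightarrow> N (S x) \<le> 1"
        "\<forall>y. N y \<le> 1 \<longrightarrow> (\<exists>q. norm q \<le> \<mu> \<and> y = S q)"
      by (elim exE conjE)
    note S = this[rule_format]
    show ?thesis
      using circumradius_le_inradius[OF N compact_imp_bounded[OF Kc(1)] i T S pos] .
  qed
  then show ?thesis using r by (simp add: divide_le_eq)
qed

theorem theorem5p2:
  fixes N :: "'a::euclidean_space \<Rightarrow> real" and K :: "'a set" and i :: nat
  assumes "is_norm N"
    and "convex_body K"
    and "1 \<le> i" and "i \<le> DIM('a)"
    and "inradius_i i K {x. N x \<le> 1} > 0"
  shows "circumradius_i (DIM('a) - i + 1) K {x. N x \<le> 1} / inradius_i i K {x. N x \<le> 1}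
           \<le> real DIM('a) * sqrt (real DIM('a))
      \<and> (((\<forall>x. N x = norm x) \<or> (\<forall>x\<in>K. - x \<in> K)) \<longrightarrow>
           circumradius_i (DIM('a) - i + 1) K {x. N x \<le> 1} / inradius_i i K {x. N x \<le> 1}
             \<le> real DIM('a))
      \<and> (((\<forall>x. N x = norm x) \<and> (\<forall>x\<in>K. - x \<in> K)) \<longrightarrow>
           circumradius_i (DIM('a) - i + 1) K {x. N x \<le> 1} / inradius_i i K {x. N x \<le> 1}
             \<le> sqrt (real DIM('a)))"
proof -
  let ?ratio = "circumradius_i (DIM('a) - i + 1) K {x. N x \<le> 1} / inradius_i i K {x. N x \<le> 1}"
  note ratio = circumradius_inradius_ratio[OF assms]
  have "?ratio \<le> real DIM('a) * sqrt (real DIM('a))" by (rule ratio) auto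
  moreover have "?ratio \<le> real DIM('a)" if "\<forall>x. N x = norm x"
    using ratio[of "real DIM('a)" 1] that by simp
  moreover have "?ratio \<le> real DIM('a)" if "\<forall>x\<in>K. - x \<in> K"
    using ratio[of "sqrt (real DIM('a))" "sqrt (real DIM('a))"] that by simp
  moreover have "?ratio \<le> sqrt (real DIM('a))" if "\<forall>x. N x = norm x" "\<forall>x\<in>K. - x \<in> K"
    using ratio[of "sqrt (real DIM('a))" 1] that by simp
  ultimately show ?thesis by blast
qed

end
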